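(* Let $G$ be a finitely generated nilpotent group and let $X$ be a Suslinian continuum. Then $G$ cannot act on $X$ expansively; that is, there is no expansive continuous action of $G$ on $X$.
   Context: A continuum is a nonempty compact connected metric space; it is nondegenerate if it is not a single point. A subcontinuum of $X$ is a subset of $X$ that is itself a continuum. A continuum $X$ is called Suslinian if it does not contain uncountably many mutually disjoint nondegenerate subcontinua. Groups are regarded as discrete groups. A continuous action of a discrete group $G$ on a compact metric space $X$ is a group homomorphism $\phi: G\to \mathrm{Homeo}(X)$, where $\mathrm{Homeo}(X)$ is the group of homeomorphisms of $X$; one writes $gx$ for $\phi(g)(x)$. The action on $(X,d)$ is expansive if there is $c>0$ such that $\sup_{g\in G} d(gx,gy)>c$ for all distinct $x,y\in X$.
   Formalization: The Suslinian continuum X is additionally assumed to be nondegenerate (not a single point); on a one-point continuum every action is vacuously expansive, so the claim as written fails there. *)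

theory Defs
  imports "HOL-Analysis.Analysis" "HOL-Algebra.Bij" "HOL-Algebra.Generated_Groups"
begin

section \<open>Suslinian continua\<close>

definition continuum :: "'a::metric_space set \<Rightarrow> bool" where
  "continuum X \<longleftrightarrow> X \<noteq> {} \<and> compact X \<and> connected X"

definition nondegenerate :: "'a set \<Rightarrow> bool" where
  "nondegenerate X \<longleftrightarrow> (\<nexists>x. X = {x})"

definition suslinian :: "'a::metric_space set \<Rightarrow> bool" where
  "suslinian X \<longleftrightarrow> continuum X \<and>
     (\<nexists>\<C>. uncountable \<C> \<and> pairwise disjnt \<C> \<and>
          (\<forall>C\<in>\<C>. C \<subseteq> X \<and> continuum C \<and> nondegenerate C))"


section \<open>Finitely generated and nilpotent groups\<close>

definition finitely_generated_group :: "('g, 'm) monoid_scheme \<Rightarrow> bool" where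
  "finitely_generated_group G \<longleftrightarrow> group G \<and>
     (\<exists>S. finite S \<and> S \<subseteq> carrier G \<and> generate G S = carrier G)"

definition commutator_subgroup :: "('g, 'm) monoid_scheme \<Rightarrow> 'g set \<Rightarrow> 'g set \<Rightarrow> 'g set" where
  "commutator_subgroup G H K =
     generate G {h \<otimes>\<^bsub>G\<^esub> k \<otimes>\<^bsub>G\<^esub> inv\<^bsub>G\<^esub> h \<otimes>\<^bsub>G\<^esub> inv\<^bsub>G\<^esub> k | h k. h \<in> H \<and> k \<in> K}"

primrec lower_central_series :: "('g, 'm) monoid_scheme \<Rightarrow> nat \<Rightarrow> 'g set" where
  "lower_central_series G 0 = carrier G"
| "lower_central_series G (Suc n) =
     commutator_subgroup G (carrier G) (lower_central_series G n)"

definition nilpotent_group :: "('g, 'm) monoid_scheme \<Rightarrow> bool" where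
  "nilpotent_group G \<longleftrightarrow> group G \<and> (\<exists>n. lower_central_series G n = {\<one>\<^bsub>G\<^esub>})"


section \<open>Continuous and expansive actions\<close>

text \<open>As in \<^const>\<open>BijGroup\<close>, a self-homeomorphism of \<open>X\<close> is represented by the function
  that agrees with it on \<open>X\<close> and is \<^const>\<open>undefined\<close> outside \<open>X\<close>.\<close>

definition HomeoGroup :: "'a::topological_space set \<Rightarrow> ('a \<Rightarrow> 'a) monoid" where
  "HomeoGroup X = BijGroup X \<lparr>carrier := {f \<in> Bij X. \<exists>g. homeomorphism X X f g}\<rparr>"

lemma subgroup_HomeoGroup: "subgroup {f \<in> Bij X. \<exists>g. homeomorphism X X f g} (BijGroup X)"
proof -
  interpret B: group "BijGroup X" by (rule group_BijGroup)
  show ?thesis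
  proof (rule B.subgroupI)
    show "{f \<in> Bij X. \<exists>g. homeomorphism X X f g} \<subseteq> carrier (BijGroup X)"
      by (auto simp: BijGroup_def)
    have "homeomorphism X X (\<lambda>x\<in>X. x) (\<lambda>x. x)"
      by (simp add: homeomorphism_def)
    then show "{f \<in> Bij X. \<exists>g. homeomorphism X X f g} \<noteq> {}"
      using id_Bij[of X] by blast
  next
    fix f assume "f \<in> {f \<in> Bij X. \<exists>g. homeomorphism X X f g}"
    then obtain g where f: "f \<in> Bij X" and g: "homeomorphism X X f g" by blast
    have eq: "inv_into X f x = g x" if "x \<in> X" for x
      using f g that unfolding homeomorphism_def Bij_def bij_betw_def
      by (metis (no_types, lifting) IntD2 image_eqI inv_into_f_eq mem_Collect_eq)
    have "homeomorphism X X (\<lambda>x\<in>X. inv_into X f x) f"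
      by (rule homeomorphism_cong[OF homeomorphism_symD[OF g]]) (auto simp: eq)
    then show "inv\<^bsub>BijGroup X\<^esub> f \<in> {f \<in> Bij X. \<exists>g. homeomorphism X X f g}"
      using f restrict_inv_into_Bij[OF f] by (auto simp: inv_BijGroup)
  next
    fix f f' assume "f \<in> {f \<in> Bij X. \<exists>g. homeomorphism X X f g}"
      and "f' \<in> {f \<in> Bij X. \<exists>g. homeomorphism X X f g}"
    then obtain g g' where f: "f \<in> Bij X" "homeomorphism X X f g"
      and f': "f' \<in> Bij X" "homeomorphism X X f' g'" by blast
    have "homeomorphism X X (compose X f f') (g' \<circ> g)"
      by (rule homeomorphism_cong[OF homeomorphism_compose[OF f'(2) f(2)]])
         (auto simp: compose_def)
    then show "f \<otimes>\<^bsub>BijGroup X\<^esub> f' \<in> {f \<in> Bij X. \<exists>g. homeomorphism X X f g}"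
      using f(1) f'(1) by (auto simp: BijGroup_def compose_Bij)
  qed
qed

lemma group_HomeoGroup: "group (HomeoGroup X)"
  unfolding HomeoGroup_def
  by (rule group.subgroup_imp_group[OF group_BijGroup subgroup_HomeoGroup])

definition continuous_action ::
  "('g, 'm) monoid_scheme \<Rightarrow> 'a::metric_space set \<Rightarrow> ('g \<Rightarrow> 'a \<Rightarrow> 'a) \<Rightarrow> bool" where
  "continuous_action G X \<phi> \<longleftrightarrow> \<phi> \<in> hom G (HomeoGroup X)"

text \<open>The supremum is taken in \<^typ>\<open>real\<close>; it is the intended one for bounded (in particular
  compact) \<open>X\<close>.\<close>

definition expansive_action ::
  "('g, 'm) monoid_scheme \<Rightarrow> 'a::metric_space set \<Rightarrow> ('g \<Rightarrow> 'a \<Rightarrow> 'a) \<Rightarrow> bool" where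
  "expansive_action G X \<phi> \<longleftrightarrow>
     (\<exists>c>0. \<forall>x\<in>X. \<forall>y\<in>X. x \<noteq> y \<longrightarrow> (SUP g\<in>carrier G. dist (\<phi> g x) (\<phi> g y)) > c)"

end

theory Submission
  imports Defs "HOL-Real_Asymp.Real_Asymp"
begin

text \<open>
  Consider families \<open>F\<close> of subcontinua of \<open>X\<close> that are closed in the Hausdorff metric, invariant under
  the action, contain a nondegenerate continuum, and are splittable: every member contains smaller
  members of definite diameter through any of its points. Expansiveness with constant \<open>c\<close> expands
  some member of such an \<open>F\<close> to diameter \<open>> c\<close>, so by compactness of the hyperspace and Zorn's lemma
  there is a minimal \<open>F\<close>. Let \<open>F'\<close> be the set of continua that are limits of arbitrarily large
  disjoint subfamilies of \<open>F\<close>; it inherits closedness, invariance and splittability. By minimality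
  either \<open>F' = F\<close>, and a Cantor scheme yields uncountably many disjoint nondegenerate continua, or
  all members of \<open>F'\<close> are points, and then by compactness the number of disjoint members of \<open>F\<close>
  of diameter \<open>> c\<close> is bounded by some \<open>M\<close>.

  The second alternative is excluded by growth. A finite set \<open>E\<close> of group elements expands all
  pairs of points at distance \<open>\<ge> c/3\<close> beyond \<open>c\<close>; splitting each continuum into two disjoint ones
  \<open>n\<close> times gives \<open>2\<^sup>n\<close> disjoint members of \<open>F\<close>, each expanded beyond \<open>c\<close> by a product of at most
  \<open>n\<close> elements of \<open>E\<close>. As \<open>G\<close> is nilpotent there are only polynomially many such products, so more
  than \<open>M\<close> of the continua share the same one for large \<open>n\<close>.
\<close>

section \<open>Polynomial growth of nilpotent groups\<close>

text \<open>The ball of radius \<open>n\<close> in the submonoid generated by \<open>A\<close>: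
  products of at most \<open>n\<close> letters, where an inverse counts only if it is itself a
  letter. Letters are added on the left, as in a composition of maps.\<close>

primrec words :: "('g, 'm) monoid_scheme \<Rightarrow> 'g set \<Rightarrow> nat \<Rightarrow> 'g set" where
  "words G A 0 = {\<one>\<^bsub>G\<^esub>}"
| "words G A (Suc n) = words G A n \<union> {a \<otimes>\<^bsub>G\<^esub> w | a w. a \<in> A \<and> w \<in> words G A n}"

text \<open>Since \<open>n + 2\<close> is at least 2, constant factors can be absorbed into the
  exponent, and the bound is meaningful for \<open>n = 0\<close> too.\<close>

definition polynomial_growth :: "('g, 'm) monoid_scheme \<Rightarrow> 'g set \<Rightarrow> bool" where
  "polynomial_growth G A \<longleftrightarrow> (\<exists>k. \<forall>n. card (words G A n) \<le> (n + 2) ^ k)"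

lemma words_mono: "m \<le> n \<Longrightarrow> words G A m \<subseteq> words G A n"
  by (induction n) (auto simp: le_Suc_eq)

lemma words_one: "\<one>\<^bsub>G\<^esub> \<in> words G A n"
  by (induction n) auto

lemma words_finite: "finite A \<Longrightarrow> finite (words G A n)"
proof (induction n)
  case (Suc n)
  have "{a \<otimes>\<^bsub>G\<^esub> w | a w. a \<in> A \<and> w \<in> words G A n} = (\<lambda>(a, w). a \<otimes>\<^bsub>G\<^esub> w) ` (A \<times> words G A n)"
    by auto
  then show ?case using Suc by simp
qed simp

context group
begin

lemma mult_inv_mult: "x \<in> carrier G \<Longrightarrow> y \<in> carrier G \<Longrightarrow> x \<otimes> (inv x \<otimes> y) = y"
  by (simp add: m_assoc [symmetric])

lemma inv_mult_mult: "x \<in> carrier G \<Longrightarrow> y \<in> carrier G \<Longrightarrow> inv x \<otimes> (x \<otimes> y) = y"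
  by (simp add: m_assoc [symmetric])

lemma words_carrier: "A \<subseteq> carrier G \<Longrightarrow> words G A n \<subseteq> carrier G"
  by (induction n) auto

lemma words_letter: "a \<in> A \<Longrightarrow> A \<subseteq> carrier G \<Longrightarrow> 0 < n \<Longrightarrow> a \<in> words G A n"
proof (cases n)
  case (Suc m)
  assume "a \<in> A" "A \<subseteq> carrier G"
  then have "a = a \<otimes> \<one>" by auto
  then show ?thesis using Suc \<open>a \<in> A\<close> words_one[of G A m] by auto
qed simp

lemma words_mult:
  assumes "A \<subseteq> carrier G" "u \<in> words G A m" "v \<in> words G A n"
  shows "u \<otimes> v \<in> words G A (m + n)"
  using assms(2)
proof (induction m arbitrary: u)
  case 0
  moreover have "v \<in> carrier G" using assms words_carrier by blast
  ultimately show ?case using assms by simp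
next
  case (Suc m)
  from Suc.prems consider "u \<in> words G A m" | a w where "u = a \<otimes> w" "a \<in> A" "w \<in> words G A m"
    by auto
  then show ?case
  proof cases
    case 1
    then show ?thesis using Suc.IH by simp
  next
    case 2
    have "a \<otimes> w \<otimes> v = a \<otimes> (w \<otimes> v)"
      using 2 assms words_carrier[OF assms(1)] by (intro m_assoc) auto
    then show ?thesis using 2 Suc.IH[OF 2(3)] by auto
  qed
qed

section \<open>Iterated commutators [f, [f, ..., [f, x]]] and the collection of a letter\<close>

definition comm_iter :: "'a \<Rightarrow> nat \<Rightarrow> 'a \<Rightarrow> 'a" where
  "comm_iter f j = (\<lambda>y. f \<otimes> y \<otimes> inv f \<otimes> inv y) ^^ j"

lemma comm_iter_0 [simp]: "comm_iter f 0 x = x"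
  by (simp add: comm_iter_def)

lemma comm_iter_Suc:
  "comm_iter f (Suc j) x = f \<otimes> comm_iter f j x \<otimes> inv f \<otimes> inv (comm_iter f j x)"
  by (simp add: comm_iter_def)

lemma comm_iter_carrier: "f \<in> carrier G \<Longrightarrow> x \<in> carrier G \<Longrightarrow> comm_iter f j x \<in> carrier G"
  by (induction j) (auto simp: comm_iter_Suc)

text \<open>If \<open>f\<close> conjugates \<open>y\<close> to \<open>[f, y] y\<close>, then conjugating by \<open>f\<^sup>k\<close> produces iterated commutators
  of \<open>f\<close> with \<open>y\<close>, as in Pascal's triangle; since the iteration stops after \<open>c\<close> steps their number is
  polynomial in \<open>k\<close>.\<close>

lemma conjugate_in_words:
  assumes f: "f \<in> carrier G" and x: "x \<in> carrier G" and c: "comm_iter f c x = \<one>"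
    and B: "B \<subseteq> carrier G" "\<And>j. j \<le> c \<Longrightarrow> comm_iter f j x \<in> B" and j: "j \<le> c"
  shows "f [^] k \<otimes> comm_iter f j x \<otimes> inv (f [^] k) \<in> words G B (Suc k ^ (c - j))"
  using j
proof (induction k arbitrary: j)
  case 0
  then show ?case
    using words_letter[OF B(2)[OF 0] B(1), of 1] comm_iter_carrier[OF f x, of j]
    by (simp del: words.simps)
next
  case (Suc k)
  let ?y = "comm_iter f j x" and ?g = "f [^] k"
  have y: "?y \<in> carrier G" and g: "?g \<in> carrier G"
    using f x comm_iter_carrier by auto
  show ?case
  proof (cases "j = c")
    case True
    then show ?thesis using c f words_one by simp
  next
    case False
    then obtain m where m: "c - j = Suc m" "c - Suc j = m" using Suc.prems
      by (metis Suc_diff_Suc le_neq_implies_less)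
    have "f [^] Suc k \<otimes> ?y \<otimes> inv (f [^] Suc k)
        = (?g \<otimes> comm_iter f (Suc j) x \<otimes> inv ?g) \<otimes> (?g \<otimes> ?y \<otimes> inv ?g)"
      using f g y by (simp add: comm_iter_Suc inv_mult_group m_assoc inv_mult_mult)
    also have "\<dots> \<in> words G B (Suc k ^ m + Suc k ^ Suc m)"
      using Suc.IH[of j] Suc.IH[of "Suc j"] Suc.prems False m by (intro words_mult[OF B(1)]) auto
    also have "\<dots> \<subseteq> words G B (Suc (Suc k) ^ Suc m)"
    proof (rule words_mono)
      have "Suc k ^ m + Suc k ^ Suc m = Suc (Suc k) * Suc k ^ m" by simp
      also have "\<dots> \<le> Suc (Suc k) * Suc (Suc k) ^ m" by (intro mult_le_mono power_mono) auto
      finally show "Suc k ^ m + Suc k ^ Suc m \<le> Suc (Suc k) ^ Suc m" by simp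
    qed
    finally show ?thesis using m by simp
  qed
qed

text \<open>All occurrences of \<open>e\<close> are collected at the front. Moving a letter
  \<open>a\<close> past \<open>e [^] k\<close> turns it into its conjugate by
  \<open>inv e [^] k\<close>, which by \<open>conjugate_in_words\<close> is a word in iterated
  commutators with \<open>inv e\<close>. The fixed bound \<open>N\<close> makes the cost
  \<open>Suc N ^ c\<close> the same for every letter throughout the induction.\<close>

lemma words_insert:
  assumes e: "e \<in> carrier G" and A: "A \<subseteq> carrier G"
    and c: "\<And>x. x \<in> A \<Longrightarrow> comm_iter (inv e) c x = \<one>"
    and B: "B = {comm_iter (inv e) j x | j x. x \<in> A \<and> j \<le> c}"
    and w: "w \<in> words G (insert e A) n" and n: "n \<le> N"
  shows "\<exists>k\<le>n. \<exists>u\<in>words G B (n * Suc N ^ c). w = e [^] k \<otimes> u"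
  using w n
proof (induction n arbitrary: w)
  case 0
  then show ?case by auto
next
  case (Suc n)
  have B': "B \<subseteq> carrier G" using B A e comm_iter_carrier by auto
  from Suc.prems(1) consider "w \<in> words G (insert e A) n"
    | a v where "w = a \<otimes> v" "a \<in> insert e A" "v \<in> words G (insert e A) n" by auto
  then show ?case
  proof cases
    case 1
    then obtain k u where "k \<le> n" "u \<in> words G B (n * Suc N ^ c)" "w = e [^] k \<otimes> u"
      using Suc.IH[of w] Suc.prems by auto
    moreover from this have "u \<in> words G B (Suc n * Suc N ^ c)"
      using words_mono[of "n * Suc N ^ c" "Suc n * Suc N ^ c" G B] by auto
    ultimately show ?thesis by (intro exI[of _ k] conjI bexI[of _ u]) simp_all
  next
    case 2
    then obtain k u where k: "k \<le> n" and u: "u \<in> words G B (n * Suc N ^ c)" and v: "v = e [^] k \<otimes> u"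
      using Suc.IH[of v] Suc.prems by auto
    have uc: "u \<in> carrier G" using u words_carrier[OF B'] by auto
    show ?thesis
    proof (cases "a = e")
      case True
      have "w = e [^] Suc k \<otimes> u"
        using 2 True v e uc nat_pow_Suc2[OF e, of k] by (simp add: m_assoc del: nat_pow_Suc)
      moreover have "u \<in> words G B (Suc n * Suc N ^ c)"
        using u words_mono[of "n * Suc N ^ c" "Suc n * Suc N ^ c" G B] by auto
      ultimately show ?thesis using k by (intro exI[of _ "Suc k"] conjI bexI[of _ u]) simp_all
    next
      case False
      then have a: "a \<in> A" "a \<in> carrier G" using 2 A by auto
      let ?h = "inv e [^] k \<otimes> comm_iter (inv e) 0 a \<otimes> inv (inv e [^] k)"
      have "?h \<in> words G B (Suc k ^ (c - 0))"
      proof (rule conjugate_in_words)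
        show "comm_iter (inv e) j a \<in> B" if "j \<le> c" for j
          using that a B by blast
      qed (use e a c B' in simp_all)
      moreover have "words G B (Suc k ^ (c - 0)) \<subseteq> words G B (Suc N ^ c)"
        using k Suc.prems by (intro words_mono) (auto intro: power_mono)
      ultimately have "?h \<otimes> u \<in> words G B (Suc N ^ c + n * Suc N ^ c)"
        using u by (intro words_mult[OF B']) auto
      moreover have "w = e [^] k \<otimes> (?h \<otimes> u)"
      proof -
        have "inv (inv e [^] k) = e [^] k" 
          using e by (simp add: nat_pow_inv)
        moreover have "inv e [^] k = inv (e [^] k)" using e by (simp add: nat_pow_inv)
        ultimately show ?thesis
          using e a uc 2 v by (simp add: m_assoc mult_inv_mult)
      qed
      ultimately show ?thesis using k unfolding mult_Suc
        by (intro exI[of _ k] conjI bexI[of _ "?h \<otimes> u"]) simp_all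
    qed
  qed
qed

text \<open>By \<open>words_insert\<close> a word of length \<open>n\<close> is determined by an
  exponent at most \<open>n\<close> and a word over \<open>B\<close> of length polynomial in
  \<open>n\<close>. Thus \<open>e\<close> leaves the alphabet while the remaining letters are
  enlarged by their commutators, and polynomials compose to polynomials.\<close>

lemma polynomial_growth_insert:
  assumes e: "e \<in> carrier G" and A: "A \<subseteq> carrier G" "finite A"
    and c: "\<And>x. x \<in> A \<Longrightarrow> comm_iter (inv e) c x = \<one>"
    and B: "B = {comm_iter (inv e) j x | j x. x \<in> A \<and> j \<le> c}"
    and "polynomial_growth G B"
  shows "polynomial_growth G (insert e A)"
proof -
  obtain k where k: "\<And>n. card (words G B n) \<le> (n + 2) ^ k"
    using assms by (auto simp: polynomial_growth_def)
  have "B = (\<lambda>(j, x). comm_iter (inv e) j x) ` ({..c} \<times> A)" using B by auto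
  then have finB: "finite B" using A by simp
  have "card (words G (insert e A) n) \<le> (n + 2) ^ Suc (Suc c * k)" for n
  proof -
    let ?W = "words G B (n * Suc n ^ c)"
    have "words G (insert e A) n \<subseteq> (\<lambda>(i, u). e [^] i \<otimes> u) ` ({..n} \<times> ?W)"
    proof
      fix w assume "w \<in> words G (insert e A) n"
      from words_insert[OF e A(1) c B this order_refl]
      show "w \<in> (\<lambda>(i, u). e [^] i \<otimes> u) ` ({..n} \<times> ?W)" by force
    qed
    then have "card (words G (insert e A) n) \<le> card ({..n} \<times> ?W)"
      using words_finite[OF finB] by (intro surj_card_le) auto
    also have "\<dots> = Suc n * card ?W" by (simp add: card_cartesian_product)
    also have "\<dots> \<le> (n + 2) * (n * Suc n ^ c + 2) ^ k"
      using k by (intro mult_le_mono) auto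
    also have "n * Suc n ^ c + 2 \<le> (n + 2) ^ Suc c"
    proof -
      have "n * Suc n ^ c + 2 * 1 \<le> n * (n + 2) ^ c + 2 * (n + 2) ^ c"
        by (intro add_mono mult_le_mono power_mono) auto
      then show ?thesis by (simp add: algebra_simps)
    qed
    then have "(n + 2) * (n * Suc n ^ c + 2) ^ k \<le> (n + 2) * ((n + 2) ^ Suc c) ^ k"
      by (intro mult_le_mono power_mono) auto
    also have "\<dots> = (n + 2) ^ Suc (Suc c * k)" by (simp only: power_mult power_Suc)
    finally show ?thesis .
  qed
  then show ?thesis unfolding polynomial_growth_def by blast
qed

section \<open>The lower central series and the elimination of letters\<close>

lemma lower_central_series_carrier: "lower_central_series G n \<subseteq> carrier G"
proof (induction n)
  case (Suc n)
  have "{h \<otimes> k \<otimes> inv h \<otimes> inv k | h k. h \<in> carrier G \<and> k \<in> lower_central_series G n} \<subseteq> carrier G"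
    using Suc by blast
  then show ?case
    unfolding lower_central_series.simps commutator_subgroup_def by (rule generate_incl)
qed simp

lemma lower_central_series_Suc: "lower_central_series G (Suc n) \<subseteq> lower_central_series G n"
proof (induction n)
  case 0
  then show ?case using lower_central_series_carrier[of 1] by simp
next
  case (Suc n)
  have "commutator_subgroup G (carrier G) (lower_central_series G (Suc n))
      \<subseteq> commutator_subgroup G (carrier G) (lower_central_series G n)"
    unfolding commutator_subgroup_def using Suc by (intro mono_generate) blast
  then show ?case by simp
qed

lemma comm_iter_lower_central_series:
  assumes "f \<in> carrier G" "x \<in> lower_central_series G d"
  shows "comm_iter f j x \<in> lower_central_series G (d + j)"
proof (induction j)
  case (Suc j)
  have "comm_iter f (Suc j) x \<in> {h \<otimes> k \<otimes> inv h \<otimes> inv k | h k. h \<in> carrier G \<and> k \<in> lower_central_series G (d + j)}"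
    unfolding comm_iter_Suc using assms(1) Suc by blast
  then show ?case
    unfolding add_Suc_right lower_central_series.simps commutator_subgroup_def by (rule generate.incl)
qed (use assms in simp)

lemma lower_central_series_antimono:
  "m \<le> n \<Longrightarrow> lower_central_series G n \<subseteq> lower_central_series G m"
  by (rule lift_Suc_antimono_le[of "lower_central_series G"]) (rule lower_central_series_Suc)

text \<open>Letters are eliminated one at a time in favour of letters lying deeper in the lower central
  series: the outer induction is on the depth, the inner one on the number of letters of minimal
  depth.\<close>

theorem nilpotent_polynomial_growth:
  assumes nil: "nilpotent_group G" and A: "finite A" "A \<subseteq> carrier G"
  shows "polynomial_growth G A"
proof -
  obtain c where c: "lower_central_series G c = {\<one>}"
    using nil by (auto simp: nilpotent_group_def)
  have "polynomial_growth G A" if "finite A" "A \<subseteq> lower_central_series G (c - m)" for A m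
    using that
  proof (induction m arbitrary: A)
    case 0
    then have "A \<subseteq> {\<one>}" using c by simp
    have "words G A n \<subseteq> {\<one>}" for n
    proof (induction n)
      case (Suc n)
      have "{a \<otimes> w | a w. a \<in> A \<and> w \<in> words G A n} \<subseteq> {\<one> \<otimes> \<one>}"
        using \<open>A \<subseteq> {\<one>}\<close> Suc by blast
      then show ?case using Suc by simp
    qed simp
    then have "card (words G A n) \<le> (n + 2) ^ 0" for n
      using card_mono[of "{\<one>}"] by fastforce
    then show ?case unfolding polynomial_growth_def by blast
  next
    case (Suc m)
    show ?case
    proof (cases "m < c")
      \<comment> \<open>Truncated subtraction: both depths are 0 here, so nothing is left to prove
        at this stage.\<close>
      case False
      then have "c - Suc m = c - m" by simp
      then show ?thesis using Suc by simp
    next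
      case True
      define d where "d = c - Suc m"
      have d: "c - m = Suc d" using True by (simp add: d_def)
      have "polynomial_growth G (S \<union> T)"
        if "finite S" "S \<subseteq> lower_central_series G d" "finite T" "T \<subseteq> lower_central_series G (Suc d)"
        for S T
        using that
      proof (induction S arbitrary: T)
        case empty
        then show ?case using Suc.IH d by auto
      next
        case (insert e S)
        have e: "e \<in> carrier G" using insert lower_central_series_carrier by blast
        have ST: "S \<union> T \<subseteq> lower_central_series G d"
          using insert lower_central_series_Suc[of d] by blast
        let ?f = "inv e"
        \<comment> \<open>The commutators of index at least 1 lie at depth \<open>Suc d\<close> and
          join \<open>T\<close>; those of index 0 are the letters of \<open>S \<union> T\<close>
          themselves. So \<open>S \<union> T'\<close> is exactly the alphabet \<open>B\<close> of
          \<open>polynomial_growth_insert\<close>, with \<open>e\<close> gone from the letters of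
          depth \<open>d\<close>.\<close>
        define T' where "T' = T \<union> (\<lambda>(j, x). comm_iter ?f (Suc j) x) ` ({..<c} \<times> (S \<union> T))"
        have "comm_iter ?f (Suc j) x \<in> lower_central_series G (Suc d)" if "x \<in> S \<union> T" for j x
          using comm_iter_lower_central_series[of ?f x d "Suc j"] e that ST
            lower_central_series_antimono[of "Suc d" "d + Suc j"] by auto
        then have "T' \<subseteq> lower_central_series G (Suc d)"
          using insert unfolding T'_def by auto
        then have "polynomial_growth G (S \<union> T')"
          using insert by (intro insert.IH) (auto simp: T'_def)
        moreover have "S \<union> T' = {comm_iter ?f j x | j x. x \<in> S \<union> T \<and> j \<le> c}" (is "_ = ?R")
        proof
          show "S \<union> T' \<subseteq> ?R"
          proof
            fix y assume "y \<in> S \<union> T'"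
            then consider "y \<in> S \<union> T" | j x where "j < c" "x \<in> S \<union> T" "y = comm_iter ?f (Suc j) x"
              unfolding T'_def by auto
            then show "y \<in> ?R"
            proof cases
              case 1
              then have "y = comm_iter ?f 0 y \<and> y \<in> S \<union> T \<and> 0 \<le> c" by simp
              then show ?thesis by blast
            next
              case 2
              then show ?thesis using Suc_leI by blast
            qed
          qed
          show "?R \<subseteq> S \<union> T'"
          proof
            fix y assume "y \<in> ?R"
            then obtain j x where jx: "y = comm_iter ?f j x" "x \<in> S \<union> T" "j \<le> c" by blast
            then show "y \<in> S \<union> T'" unfolding T'_def by (cases j) force+
          qed
        qed
        moreover have "comm_iter ?f c x = \<one>" if "x \<in> S \<union> T" for x
          using comm_iter_lower_central_series[of ?f x d c] e that ST c
            lower_central_series_antimono[of c "d + c"] by auto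
        ultimately have "polynomial_growth G (insert e (S \<union> T))"
          using insert ST lower_central_series_carrier[of d] e
          by (intro polynomial_growth_insert[where c = c and B = "S \<union> T'"]) auto
        then show ?case by simp
      qed
      from this[of A "{}"] show ?thesis using Suc.prems d_def by simp
    qed
  qed
  from this[of A c] show ?thesis using A by simp
qed

end

section \<open>Compactness of the hyperspace of subcontinua\<close>

definition subcontinua :: "'a::metric_space set \<Rightarrow> 'a set set" where
  "subcontinua X = {A. A \<subseteq> X \<and> continuum A}"

text \<open>For nonempty compact sets this says that their Hausdorff distance is below
  \<open>e\<close>.\<close>

definition near :: "real \<Rightarrow> 'a::metric_space set \<Rightarrow> 'a set \<Rightarrow> bool" where
  "near e A B \<longleftrightarrow> (\<forall>a\<in>A. \<exists>b\<in>B. dist a b < e) \<and> (\<forall>b\<in>B. \<exists>a\<in>A. dist a b < e)"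

lemma near_sym: "near e A B \<Longrightarrow> near e B A"
  by (simp add: near_def dist_commute)

lemma near_refl: "0 < e \<Longrightarrow> near e A A"
  by (force simp: near_def)

lemma near_mono: "near d A B \<Longrightarrow> d \<le> e \<Longrightarrow> near e A B"
  unfolding near_def by (meson less_le_trans)

lemma near_trans:
  assumes "near d A B" "near e B C"
  shows "near (d + e) A C"
  unfolding near_def
proof (intro conjI ballI)
  fix a assume "a \<in> A"
  then obtain b c where "b \<in> B" "dist a b < d" "c \<in> C" "dist b c < e"
    using assms unfolding near_def by meson
  then show "\<exists>c\<in>C. dist a c < d + e" using dist_triangle[of a c b] by (intro bexI[of _ c]) auto
next
  fix c assume "c \<in> C"
  then obtain b a where "b \<in> B" "dist a b < d" "a \<in> A" "dist b c < e"
    using assms unfolding near_def by meson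
  then show "\<exists>a\<in>A. dist a c < d + e" using dist_triangle[of a c b] by (intro bexI[of _ a]) auto
qed

text \<open>Ensures that a limit of continua whose diameters exceed a fixed \<open>r\<close> does
  not shrink to a point.\<close>

lemma near_imp_nontrivial:
  assumes "near (r / 2) B L" "u \<in> B" "v \<in> B" "r < dist u v"
  shows "\<exists>x\<in>L. \<exists>y\<in>L. x \<noteq> y"
proof -
  obtain x y where xy: "x \<in> L" "dist u x < r / 2" "y \<in> L" "dist v y < r / 2"
    using assms unfolding near_def by blast
  then have "x \<noteq> y" using assms(4) dist_triangle2[of u v x] by auto
  then show ?thesis using xy by blast
qed

lemma compact_finite_net:
  fixes X :: "'a::metric_space set"
  assumes "compact X" "0 < e"
  obtains Y where "finite Y" "Y \<subseteq> X" "X \<subseteq> (\<Union>y\<in>Y. ball y e)"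
proof (rule compactE_image[OF assms(1), of X "\<lambda>y. ball y e"])
  show "X \<subseteq> (\<Union>y\<in>X. ball y e)" using assms by auto
qed (use that in auto)

lemma compact_closed_separation:
  fixes C D :: "'a::metric_space set"
  assumes "compact C" "closed D" "C \<inter> D = {}"
  obtains s where "0 < s" "\<And>x y. x \<in> C \<Longrightarrow> y \<in> D \<Longrightarrow> s \<le> dist x y"
proof (cases "C = {} \<or> D = {}")
  case True
  then show thesis using that[of 1] by auto
next
  case False
  have "continuous_on C (\<lambda>x. infdist x D)" by (intro continuous_intros)
  then obtain c where c: "c \<in> C" "\<And>x. x \<in> C \<Longrightarrow> infdist c D \<le> infdist x D"
    using continuous_attains_inf[OF assms(1)] False by blast
  have "infdist c D \<noteq> 0" using c assms False in_closed_iff_infdist_zero by blast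
  then have "0 < infdist c D" using infdist_nonneg[of c D] by linarith
  moreover have "infdist c D \<le> dist x y" if "x \<in> C" "y \<in> D" for x y
    using c(2)[OF that(1)] infdist_le[OF that(2), of x] by linarith
  ultimately show thesis using that by blast
qed

section \<open>Convergence of continua along ultrafilters\<close>

text \<open>Zorn's lemma gives a minimal proper filter below \<Phi>. It decides every
  \<open>P\<close>: unless the negation holds eventually, restricting the filter to \<open>P\<close>
  leaves it proper, so by minimality does not change it.\<close>

lemma ultrafilter_refinement:
  assumes "\<Phi> \<noteq> bot"
  obtains U where "U \<le> \<Phi>" "U \<noteq> bot" "\<And>P. eventually P U \<or> eventually (\<lambda>x. \<not> P x) U"
proof -
  define \<A> where "\<A> = {U. U \<le> \<Phi> \<and> U \<noteq> bot}"
  have "\<exists>U\<in>\<A>. \<forall>V\<in>\<A>. V \<le> U \<longrightarrow> V = U"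
  proof (rule predicate_Zorn[of \<A> "\<lambda>U V. V \<le> U"])
    show "partial_order_on \<A> (relation_of (\<lambda>U V. V \<le> U) \<A>)"
      by (rule partial_order_on_relation_ofI) auto
  next
    fix C assume "C \<in> Chains (relation_of (\<lambda>U V. V \<le> U) \<A>)"
    then have C: "C \<subseteq> \<A>" "\<And>U V. U \<in> C \<Longrightarrow> V \<in> C \<Longrightarrow> U \<le> V \<or> V \<le> U"
      by (auto simp: Chains_def relation_of_def)
    show "\<exists>U\<in>\<A>. \<forall>V\<in>C. U \<le> V"
    proof (cases "C = {}")
      case True
      then show ?thesis using assms by (auto simp: \<A>_def)
    next
      case False
      \<comment> \<open>In a chain, whatever holds eventually for the infimum already holds
        eventually for one member; hence the infimum is proper.\<close>
      have "eventually P (Inf C) \<longleftrightarrow> (\<exists>U\<in>C. eventually P U)" for P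
        using C(2) by (intro eventually_Inf_base[OF False]) (metis inf.absorb1 inf.absorb2 order_refl)
      then have "Inf C \<noteq> bot"
        using C(1) unfolding trivial_limit_def \<A>_def by auto
      moreover have "Inf C \<le> \<Phi>"
        using False C(1) by (auto simp: \<A>_def intro: Inf_lower2)
      ultimately show ?thesis using Inf_lower[of _ C] by (auto simp: \<A>_def)
    qed
  qed
  then obtain U where U: "U \<in> \<A>" "\<And>V. V \<in> \<A> \<Longrightarrow> V \<le> U \<Longrightarrow> V = U" by blast
  have "eventually P U \<or> eventually (\<lambda>x. \<not> P x) U" for P
  proof (rule disjCI)
    assume n: "\<not> eventually (\<lambda>x. \<not> P x) U"
    let ?V = "inf U (principal {x. P x})"
    have "?V \<noteq> bot"
      using n by (simp add: trivial_limit_def eventually_inf_principal)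
    then have "?V \<in> \<A>" using U(1) by (auto simp: \<A>_def intro: le_infI1)
    then have "?V = U" using U(2) by simp
    moreover have "eventually P ?V" by (simp add: eventually_inf_principal)
    ultimately show "eventually P U" by simp
  qed
  then show thesis using that U(1) by (auto simp: \<A>_def)
qed

text \<open>The two parts of a separation of \<open>L\<close> have positive distance
  \<open>s\<close>. A connected set within \<open>s / 2\<close> of \<open>L\<close> would be covered
  by the disjoint \<open>s / 2\<close>-neighbourhoods of the parts and meet both.\<close>

lemma connected_if_approximated:
  fixes L :: "'a::metric_space set"
  assumes "compact L" and conn: "\<And>e. 0 < e \<Longrightarrow> \<exists>A. connected A \<and> near e A L"
  shows "connected L"
proof (rule ccontr)
  assume "\<not> connected L"
  then obtain C D where CD: "closed C" "closed D" "L = C \<union> D" "C \<inter> D = {}" "C \<noteq> {}" "D \<noteq> {}"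
    using connected_closed_set[OF compact_imp_closed[OF assms(1)]] by metis
  have "compact C"
    using CD assms(1) compact_Int_closed[of L C] by (simp add: Int_absorb1)
  then obtain s where s: "0 < s" "\<And>x y. x \<in> C \<Longrightarrow> y \<in> D \<Longrightarrow> s \<le> dist x y"
    using compact_closed_separation[OF _ CD(2,4)] by metis
  obtain A where A: "connected A" "near (s / 2) A L" using conn s(1) by (meson half_gt_zero)
  let ?U = "\<Union>x\<in>C. ball x (s / 2)" and ?V = "\<Union>x\<in>D. ball x (s / 2)"
  have "?U \<inter> ?V = {}"
  proof (rule ccontr)
    assume "?U \<inter> ?V \<noteq> {}"
    then obtain z x y where "x \<in> C" "y \<in> D" "dist x z < s / 2" "dist y z < s / 2" by auto
    then show False using s(2)[of x y] dist_triangle2[of x y z] by auto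
  qed
  moreover have "A \<subseteq> ?U \<union> ?V"
  proof
    fix a assume "a \<in> A"
    then obtain x where "x \<in> L" "dist x a < s / 2"
      using A(2) unfolding near_def by (metis dist_commute)
    then show "a \<in> ?U \<union> ?V" using CD(3) by auto
  qed
  moreover have "?U \<inter> A \<noteq> {}" "?V \<inter> A \<noteq> {}"
  proof -
    have *: "\<exists>a\<in>A. dist x a < s / 2" if "x \<in> L" for x
      using A(2) that unfolding near_def by (metis dist_commute)
    obtain c d where "c \<in> C" "d \<in> D" using CD(5,6) by blast
    with * CD(3) obtain a b where "a \<in> A" "dist c a < s / 2" "b \<in> A" "dist d b < s / 2" by blast
    then have "a \<in> ?U \<inter> A" "b \<in> ?V \<inter> A" using \<open>c \<in> C\<close> \<open>d \<in> D\<close> by auto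
    then show "?U \<inter> A \<noteq> {}" "?V \<inter> A \<noteq> {}" by blast+
  qed
  ultimately show False
    using connectedD[OF A(1), of ?U ?V] by auto
qed

text \<open>Compactness of the hyperspace, stated for filters so that it serves sequences as well as
  chains of families. Along an ultrafilter below \<Phi> the continua converge to the set
  \<open>L\<close> of points all of whose balls are eventually hit; convergence along the finer
  filter gives clustering along \<Phi>.\<close>

theorem subcontinua_cluster_point:
  fixes X :: "'a::metric_space set" and A :: "'i \<Rightarrow> 'a set"
  assumes X: "compact X" and "\<Phi> \<noteq> bot" and A: "\<forall>\<^sub>F i in \<Phi>. A i \<in> subcontinua X"
  obtains L where "L \<in> subcontinua X" "\<And>e. 0 < e \<Longrightarrow> \<exists>\<^sub>F i in \<Phi>. near e (A i) L"
proof -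
  obtain U where U: "U \<le> \<Phi>" "U \<noteq> bot" and ultra: "\<And>P. eventually P U \<or> eventually (\<lambda>x. \<not> P x) U"
    using ultrafilter_refinement assms(2) by metis
  have AU: "\<forall>\<^sub>F i in U. A i \<in> subcontinua X" using A U(1) by (rule filter_leD[rotated])
  define L where "L = {x \<in> X. \<forall>e>0. \<forall>\<^sub>F i in U. A i \<inter> ball x e \<noteq> {}}"
  \<comment> \<open>Points chosen in the hit balls push \<open>U\<close> forward to a filter on a
    compact set. It has a cluster point, and since \<open>U\<close> decides every predicate, the
    balls around this point are hit eventually and not just frequently.\<close>
  have hit: "\<exists>x\<in>L. dist y x \<le> e" if "\<forall>\<^sub>F i in U. A i \<inter> ball y e \<noteq> {}" for y e
  proof -
    have "\<forall>i. \<exists>a. A i \<inter> ball y e \<noteq> {} \<longrightarrow> a \<in> A i \<inter> ball y e" by blast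
    then obtain a where "\<And>i. A i \<inter> ball y e \<noteq> {} \<Longrightarrow> a i \<in> A i \<inter> ball y e" by metis
    then have a: "\<forall>\<^sub>F i in U. a i \<in> A i \<inter> ball y e"
      using that by (rule eventually_mono[rotated])
    then have "\<forall>\<^sub>F i in U. a i \<in> X \<inter> cball y e"
      using AU by eventually_elim (auto simp: subcontinua_def)
    then have "eventually (\<lambda>x. x \<in> X \<inter> cball y e) (filtermap a U)"
      by (simp add: eventually_filtermap)
    moreover have "compact (X \<inter> cball y e)" using X by (simp add: compact_Int_closed)
    moreover have "filtermap a U \<noteq> bot" using U(2) by (simp add: filtermap_bot_iff)
    ultimately obtain x where x: "x \<in> X \<inter> cball y e" "inf (nhds x) (filtermap a U) \<noteq> bot"
      unfolding compact_filter by metis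
    have "\<forall>\<^sub>F i in U. A i \<inter> ball x d \<noteq> {}" if "0 < d" for d
    proof -
      have "\<not> (\<forall>\<^sub>F i in U. a i \<notin> ball x d)"
      proof
        assume "\<forall>\<^sub>F i in U. a i \<notin> ball x d"
        then have "eventually (\<lambda>z. z \<notin> ball x d) (filtermap a U)" by (simp add: eventually_filtermap)
        moreover have "eventually (\<lambda>z. z \<in> ball x d) (nhds x)"
          using that by (intro eventually_nhds_in_open) auto
        ultimately have "eventually (\<lambda>_. False) (inf (nhds x) (filtermap a U))"
          unfolding eventually_inf by blast
        then show False using x(2) by (simp add: trivial_limit_def)
      qed
      then have "\<forall>\<^sub>F i in U. a i \<in> ball x d" using ultra by blast
      then show ?thesis using a by eventually_elim auto
    qed
    then have "x \<in> L" using x(1) by (auto simp: L_def)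
    then show ?thesis using x(1) by auto
  qed
  \<comment> \<open>A finite net reduces nearness to finitely many eventual statements, one in each
    direction for every net point.\<close>
  have nearL: "\<forall>\<^sub>F i in U. near e (A i) L" if "0 < e" for e
  proof -
    have "0 < e / 3" using that by simp
    then obtain Y where Y: "finite Y" "Y \<subseteq> X" "X \<subseteq> (\<Union>y\<in>Y. ball y (e / 3))"
      by (rule compact_finite_net[OF X])
    have "\<forall>\<^sub>F i in U. A i \<inter> ball y (e / 3) \<noteq> {} \<longrightarrow> (\<exists>x\<in>L. dist y x \<le> e / 3)" for y
    proof (cases "\<forall>\<^sub>F i in U. A i \<inter> ball y (e / 3) \<noteq> {}")
      case True
      then show ?thesis using hit[of y "e / 3"] by simp
    next
      case False
      then have "\<forall>\<^sub>F i in U. \<not> A i \<inter> ball y (e / 3) \<noteq> {}" using ultra by blast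
      then show ?thesis by (rule eventually_mono) simp
    qed
    then have 1: "\<forall>\<^sub>F i in U. \<forall>y\<in>Y. A i \<inter> ball y (e / 3) \<noteq> {} \<longrightarrow> (\<exists>x\<in>L. dist y x \<le> e / 3)"
      using Y(1) by (simp add: eventually_ball_finite)
    have "\<forall>\<^sub>F i in U. L \<inter> ball y (e / 3) \<noteq> {} \<longrightarrow> (\<exists>a\<in>A i. dist y a < 2 * e / 3)" for y
    proof (cases "L \<inter> ball y (e / 3) = {}")
      case False
      then obtain x where x: "x \<in> L" "dist y x < e / 3" by auto
      then have "\<forall>\<^sub>F i in U. A i \<inter> ball x (e / 3) \<noteq> {}" using that by (auto simp: L_def)
      then show ?thesis
      proof eventually_elim
        case (elim i)
        then obtain a where "a \<in> A i" "dist x a < e / 3" by auto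
        then show ?case using x dist_triangle[of y a x] by (intro impI bexI[of _ a]) auto
      qed
    qed simp
    then have 2: "\<forall>\<^sub>F i in U. \<forall>y\<in>Y. L \<inter> ball y (e / 3) \<noteq> {} \<longrightarrow> (\<exists>a\<in>A i. dist y a < 2 * e / 3)"
      using Y(1) by (simp add: eventually_ball_finite)
    show ?thesis using 1 2 AU
    proof eventually_elim
      case (elim i)
      show ?case unfolding near_def
      proof (intro conjI ballI)
        fix a assume a: "a \<in> A i"
        then have "a \<in> X" using elim by (auto simp: subcontinua_def)
        then obtain y where y: "y \<in> Y" "dist y a < e / 3" using Y(3) by auto
        then obtain x where "x \<in> L" "dist y x \<le> e / 3" using elim a by fastforce
        then show "\<exists>x\<in>L. dist a x < e"
          using y dist_triangle3[of a x y] that by (intro bexI[of _ x]) auto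
      next
        fix x assume x: "x \<in> L"
        then have "x \<in> X" by (auto simp: L_def)
        then obtain y where y: "y \<in> Y" "dist y x < e / 3" using Y(3) by auto
        then obtain a where "a \<in> A i" "dist y a < 2 * e / 3" using elim x by fastforce
        then show "\<exists>a\<in>A i. dist a x < e"
          using y dist_triangle3[of a x y] by (intro bexI[of _ a]) auto
      qed
    qed
  qed
  have ex: "\<exists>i. A i \<in> subcontinua X \<and> near e (A i) L" if "0 < e" for e
    using eventually_happens'[OF U(2) eventually_conj[OF AU nearL[OF that]]] by blast
  have "closed L"
    unfolding closure_subset_eq[symmetric]
  proof
    fix x assume x: "x \<in> closure L"
    have "closure L \<subseteq> X" using X by (intro closure_minimal compact_imp_closed) (auto simp: L_def)
    moreover have "\<forall>\<^sub>F i in U. A i \<inter> ball x e \<noteq> {}" if "0 < e" for e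
    proof -
      have "0 < e / 2" using that by simp
      then obtain y where y: "y \<in> L" "dist y x < e / 2"
        using x unfolding closure_approachable by blast
      then have "\<forall>\<^sub>F i in U. A i \<inter> ball y (e / 2) \<noteq> {}" using that by (auto simp: L_def)
      then show ?thesis
      proof eventually_elim
        case (elim i)
        then obtain a where "a \<in> A i" "dist y a < e / 2" by auto
        then show ?case using y dist_triangle3[of x a y] by (auto simp: disjoint_iff)
      qed
    qed
    ultimately show "x \<in> L" using x by (auto simp: L_def)
  qed
  moreover have LX: "L \<subseteq> X" by (auto simp: L_def)
  ultimately have "compact L" using X compact_Int_closed[of X L] by (simp add: Int_absorb1)
  moreover have "connected L"
    using \<open>compact L\<close> ex by (intro connected_if_approximated) (auto simp: subcontinua_def continuum_def)
  moreover have "L \<noteq> {}"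
    using ex[of 1] by (auto simp: subcontinua_def continuum_def near_def)
  ultimately have "L \<in> subcontinua X" using LX by (simp add: subcontinua_def continuum_def)
  moreover have "\<exists>\<^sub>F i in \<Phi>. near e (A i) L" if "0 < e" for e
    unfolding frequently_def
  proof
    assume "\<forall>\<^sub>F i in \<Phi>. \<not> near e (A i) L"
    then have "\<forall>\<^sub>F i in U. \<not> near e (A i) L" using U(1) by (rule filter_leD[rotated])
    then have "\<forall>\<^sub>F i in U. False" using nearL[OF that] by eventually_elim auto
    then show False using U(2) by (simp add: trivial_limit_def)
  qed
  ultimately show thesis using that by blast
qed

section \<open>Crowded continua and splittable families\<close>

text \<open>Two disjoint approximants would suffice for the Cantor scheme below, but arbitrarily many
  (\<open>m\<close>) are needed for this derivative to preserve splittability: small pieces cut out of disjoint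
  continua close to each other need not be close, so a common limit is found by pigeonhole.\<close>

definition crowded :: "'a::metric_space set \<Rightarrow> 'a set set \<Rightarrow> 'a set set" where
  "crowded X F = {A \<in> subcontinua X. \<forall>e>0. \<forall>m. \<exists>D\<subseteq>F. finite D \<and> card D = m \<and>
     pairwise disjnt D \<and> (\<forall>B\<in>D. near e B A)}"

definition near_closed :: "'a::metric_space set \<Rightarrow> 'a set set \<Rightarrow> bool" where
  "near_closed X F \<longleftrightarrow> F \<subseteq> subcontinua X \<and>
     (\<forall>L\<in>subcontinua X. (\<forall>e>0. \<exists>A\<in>F. near e A L) \<longrightarrow> L \<in> F)"

text \<open>A family need not be closed under subcontinua; this weaker property survives limits.\<close>

definition splittable :: "'a::metric_space set set \<Rightarrow> bool" where
  "splittable F \<longleftrightarrow> (\<forall>A\<in>F. \<forall>p\<in>A. \<forall>d>0. (\<exists>q\<in>A. d < dist p q) \<longrightarrow>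
     (\<exists>B\<in>F. p \<in> B \<and> B \<subseteq> A \<inter> cball p d \<and> (\<exists>r\<in>B. d \<le> dist p r)))"

lemma splittableD:
  assumes "splittable F" "A \<in> F" "p \<in> A" "q \<in> A" "0 < d" "d < dist p q"
  obtains B r where "B \<in> F" "p \<in> B" "B \<subseteq> A" "B \<subseteq> cball p d" "r \<in> B" "d \<le> dist p r"
proof -
  have "\<exists>q\<in>A. d < dist p q" using assms by blast
  then have "\<exists>B\<in>F. p \<in> B \<and> B \<subseteq> A \<inter> cball p d \<and> (\<exists>r\<in>B. d \<le> dist p r)"
    using assms(1,2,3,5) unfolding splittable_def by simp
  then show thesis using that by blast
qed

lemma near_closedD:
  "near_closed X F \<Longrightarrow> L \<in> subcontinua X \<Longrightarrow> (\<And>e. 0 < e \<Longrightarrow> \<exists>A\<in>F. near e A L) \<Longrightarrow> L \<in> F"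
  by (simp add: near_closed_def)

lemma near_closed_subset: "near_closed X F \<Longrightarrow> F \<subseteq> subcontinua X"
  by (simp add: near_closed_def)

section \<open>Limits of many disjoint continua\<close>

text \<open>Continua that meet the same balls around a finite \<open>e / 2\<close>-net are
  \<open>e\<close>-near. \<open>N\<close> is the number of subsets of the net, so
  \<open>m * N\<close> continua contain \<open>m\<close> with the same trace, by pigeonhole.\<close>

lemma subcontinua_totally_bounded:
  fixes X :: "'a::metric_space set"
  assumes X: "compact X" and e: "0 < e"
  obtains N :: nat where "\<And>D m. D \<subseteq> subcontinua X \<Longrightarrow> finite D \<Longrightarrow> card D = m * N \<Longrightarrow>
    \<exists>E\<subseteq>D. card E = m \<and> (\<forall>A\<in>E. \<forall>B\<in>E. near e A B)"
proof -
  have "0 < e / 2" using e by simp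
  then obtain Y where Y: "finite Y" "Y \<subseteq> X" "X \<subseteq> (\<Union>y\<in>Y. ball y (e / 2))"
    by (rule compact_finite_net[OF X])
  define code where "code A = {y \<in> Y. A \<inter> ball y (e / 2) \<noteq> {}}" for A
  have half: "\<exists>b\<in>B. dist a b < e" if "A \<in> subcontinua X" "code A = code B" "a \<in> A" for A B a
  proof -
    have "a \<in> X" using that by (auto simp: subcontinua_def)
    then obtain y where y: "y \<in> Y" "dist y a < e / 2" using Y(3) by auto
    then have "y \<in> code A" using that(3) by (auto simp: code_def)
    then have "y \<in> code B" using that by simp
    then obtain b where "b \<in> B" "dist y b < e / 2" by (auto simp: code_def)
    then show ?thesis using y dist_triangle3[of a b y] by (intro bexI[of _ b]) auto
  qed
  have close: "near e A B" if "A \<in> subcontinua X" "B \<in> subcontinua X" "code A = code B" for A B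
    unfolding near_def using half[OF that(1) that(3)] half[OF that(2) that(3)[symmetric]]
    by (metis dist_commute)
  have "\<exists>E\<subseteq>D. card E = m \<and> (\<forall>A\<in>E. \<forall>B\<in>E. near e A B)"
    if D: "D \<subseteq> subcontinua X" "finite D" "card D = m * card (Pow Y)" for D m
  proof -
    obtain c where "card D \<le> card (code -` {c} \<inter> D) * card (Pow Y)"
      using pigeonhole_card[of code D "Pow Y"] D(2) Y(1) by (force simp: code_def)
    moreover have "0 < card (Pow Y)" using Y(1) by (simp add: card_Pow)
    ultimately have "m \<le> card (code -` {c} \<inter> D)" using D(3) by simp
    then obtain E where E: "E \<subseteq> code -` {c} \<inter> D" "card E = m"
      by (rule obtain_subset_with_card_n)
    then have "near e A B" if "A \<in> E" "B \<in> E" for A B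
      using that D(1) by (intro close) auto
    then show ?thesis using E by (intro exI[of _ E]) auto
  qed
  then show thesis by (rule that)
qed

text \<open>At scale \<open>inverse (Suc n)\<close> the pigeonhole yields \<open>Suc n\<close>
  disjoint, mutually near members with property \<open>Q\<close>. A cluster point of one
  representative per scale is then approximated by all the members at that scale, so it is crowded.
  \<open>Q\<close> records what the approximants satisfy up to an error; it is not assumed monotone
  in the error, hence the separate \<open>d \<le> e\<close>.\<close>

lemma crowded_member_exists:
  fixes X :: "'a::metric_space set"
  assumes X: "compact X" and F: "F \<subseteq> subcontinua X"
    and D: "\<And>e m. 0 < e \<Longrightarrow> \<exists>D\<subseteq>F. finite D \<and> card D = m \<and> pairwise disjnt D \<and> (\<forall>B\<in>D. Q e B)"
  shows "\<exists>L\<in>crowded X F. \<forall>e>0. \<exists>B\<in>F. \<exists>d>0. d \<le> e \<and> Q d B \<and> near e B L"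
proof -
  have "\<exists>E\<subseteq>F. finite E \<and> card E = Suc n \<and> pairwise disjnt E \<and> (\<forall>B\<in>E. Q (inverse (Suc n)) B) \<and>
     (\<forall>A\<in>E. \<forall>B\<in>E. near (inverse (Suc n)) A B)" for n :: nat
  proof -
    let ?e = "inverse (real (Suc n))"
    have e: "0 < ?e" by simp
    then obtain N where N: "\<And>D m. D \<subseteq> subcontinua X \<Longrightarrow> finite D \<Longrightarrow> card D = m * N \<Longrightarrow>
      \<exists>E\<subseteq>D. card E = m \<and> (\<forall>A\<in>E. \<forall>B\<in>E. near ?e A B)"
      using subcontinua_totally_bounded[OF X] by metis
    obtain D where D': "D \<subseteq> F" "finite D" "card D = Suc n * N" "pairwise disjnt D" "\<forall>B\<in>D. Q ?e B"
      using D[OF e] by blast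
    then obtain E where E: "E \<subseteq> D" "card E = Suc n" "\<forall>A\<in>E. \<forall>B\<in>E. near ?e A B"
      using N[of D "Suc n"] F by blast
    moreover have "E \<subseteq> F" "finite E" "pairwise disjnt E" "\<forall>B\<in>E. Q ?e B"
      using D' E(1) finite_subset[of E D] pairwise_subset[of disjnt D E] by auto
    ultimately show ?thesis by blast
  qed
  then obtain E where E: "\<And>n. E n \<subseteq> F \<and> finite (E n) \<and> card (E n) = Suc n \<and> pairwise disjnt (E n)
      \<and> (\<forall>B\<in>E n. Q (inverse (Suc n)) B) \<and> (\<forall>A\<in>E n. \<forall>B\<in>E n. near (inverse (Suc n)) A B)"
    by metis
  have "\<exists>B. B \<in> E n" for n using E[of n] by (metis card.empty equals0I nat.distinct(1))
  then obtain B where B: "\<And>n. B n \<in> E n" by metis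
  have "\<forall>\<^sub>F n in sequentially. B n \<in> subcontinua X"
    using B E F by (intro always_eventually) blast
  then obtain L where L: "L \<in> subcontinua X" "\<And>e. 0 < e \<Longrightarrow> \<exists>\<^sub>F n in sequentially. near e (B n) L"
    using subcontinua_cluster_point[OF X sequentially_bot] by metis
  have ex: "\<exists>n\<ge>m. inverse (Suc n) < e \<and> near e (B n) L" if e: "0 < e" for e m
  proof -
    obtain k where k: "inverse (Suc k) < e" using reals_Archimedean[OF e] by blast
    have "\<exists>n\<ge>max m k. near e (B n) L"
      using L(2)[OF e] unfolding frequently_sequentially by blast
    then obtain n where n: "n \<ge> m" "n \<ge> k" "near e (B n) L" by auto
    then have "inverse (real (Suc n)) \<le> inverse (Suc k)" by simp
    then have "inverse (real (Suc n)) < e" using k by linarith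
    then show ?thesis using n by blast
  qed
  have "\<exists>D\<subseteq>F. finite D \<and> card D = m \<and> pairwise disjnt D \<and> (\<forall>B\<in>D. near e B L)" if e: "0 < e" for e m
  proof -
    have "0 < e / 2" using e by simp
    then obtain n where n: "n \<ge> m" "inverse (Suc n) < e / 2" "near (e / 2) (B n) L"
      using ex by blast
    have "near e C L" if "C \<in> E n" for C
    proof -
      have "near (inverse (Suc n)) C (B n)" using E[of n] B[of n] that by blast
      from near_trans[OF this n(3)] show ?thesis by (rule near_mono) (use n in simp)
    qed
    moreover have "m \<le> card (E n)" using E[of n] n(1) by simp
    then obtain D where D: "D \<subseteq> E n" "card D = m" by (rule obtain_subset_with_card_n)
    moreover have "D \<subseteq> F" "finite D" "pairwise disjnt D"
      using E[of n] D(1) finite_subset[of D "E n"] pairwise_subset[of disjnt "E n" D] by auto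
    ultimately show ?thesis by blast
  qed
  then have "L \<in> crowded X F" using L(1) by (simp add: crowded_def)
  moreover have "\<exists>B\<in>F. \<exists>d>0. d \<le> e \<and> Q d B \<and> near e B L" if e: "0 < e" for e
  proof -
    obtain n where n: "inverse (Suc n) < e" "near e (B n) L" using ex[OF e, of 0] by auto
    have "B n \<in> F" "Q (inverse (Suc n)) (B n)" using E[of n] B[of n] by blast+
    moreover have "0 < inverse (real (Suc n))" by simp
    ultimately show ?thesis using n less_imp_le by metis
  qed
  ultimately show ?thesis by blast
qed

lemma crowded_subset:
  assumes F: "near_closed X F"
  shows "crowded X F \<subseteq> F"
proof
  fix A assume A: "A \<in> crowded X F"
  have "\<exists>B\<in>F. near e B A" if "0 < e" for e
  proof -
    have "\<exists>D\<subseteq>F. finite D \<and> card D = 1 \<and> pairwise disjnt D \<and> (\<forall>B\<in>D. near e B A)"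
      using A that unfolding crowded_def by blast
    then obtain D B where "D \<subseteq> F" "D = {B}" "\<forall>B\<in>D. near e B A"
      by (metis card_1_singletonE)
    then show ?thesis by blast
  qed
  moreover have "A \<in> subcontinua X" using A by (simp add: crowded_def)
  ultimately show "A \<in> F" using F by (intro near_closedD[of X F]) auto
qed

lemma near_closed_crowded:
  assumes "F \<subseteq> subcontinua X"
  shows "near_closed X (crowded X F)"
  unfolding near_closed_def
proof (intro conjI ballI impI)
  show "crowded X F \<subseteq> subcontinua X" by (auto simp: crowded_def)
next
  fix L assume L: "L \<in> subcontinua X" "\<forall>e>0. \<exists>A\<in>crowded X F. near e A L"
  have "\<exists>D\<subseteq>F. finite D \<and> card D = m \<and> pairwise disjnt D \<and> (\<forall>B\<in>D. near e B L)" if "0 < e" for e m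
  proof -
    have e2: "0 < e / 2" using that by simp
    then obtain A where A: "A \<in> crowded X F" "near (e / 2) A L" using L(2) by blast
    then obtain D where D: "D \<subseteq> F" "finite D" "card D = m" "pairwise disjnt D" "\<forall>B\<in>D. near (e / 2) B A"
      using e2 unfolding crowded_def by blast
    then have "near e B L" if "B \<in> D" for B
      using near_trans[of "e / 2" B A "e / 2" L] A(2) that by simp
    then show ?thesis using D by blast
  qed
  then show "L \<in> crowded X F" using L(1) by (simp add: crowded_def)
qed

text \<open>The conclusion of \<open>splittable\<close> is made of closed conditions, with weak
  inequalities and a closed ball, so it passes to limits. The base point \<open>p'\<close> and the
  surrounding set \<open>A'\<close> may vary along the approximation as long as they converge to
  \<open>p\<close> and \<open>A\<close>.\<close>

lemma near_limit_in_cball: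
  fixes L :: "'a::metric_space set"
  assumes L: "compact L" and A: "closed A"
    and lim: "\<And>e. 0 < e \<Longrightarrow> \<exists>B. near e B L \<and> (\<exists>A'. B \<subseteq> A' \<and> near e A' A) \<and>
      (\<exists>p'\<in>B. dist p p' < e \<and> B \<subseteq> cball p' d \<and> (\<exists>r\<in>B. d \<le> dist p' r))"
  shows "p \<in> L" "L \<subseteq> A \<inter> cball p d" "\<exists>r\<in>L. d \<le> dist p r"
proof -
  have p: "\<exists>l\<in>L. dist l p < e" if e: "0 < e" for e
  proof -
    have "0 < e / 2" using e by simp
    from lim[OF this] obtain B p' where "near (e / 2) B L" "p' \<in> B" "dist p p' < e / 2" by blast
    then obtain l where "l \<in> L" "dist p' l < e / 2" unfolding near_def by blast
    then show ?thesis using \<open>dist p p' < e / 2\<close> dist_triangle[of p l p']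
      by (intro bexI[of _ l]) (auto simp: dist_commute)
  qed
  then have "p \<in> closure L" by (simp add: closure_approachable)
  then show "p \<in> L" using L by (simp add: compact_imp_closed)
  show "L \<subseteq> A \<inter> cball p d"
  proof
    fix l assume l: "l \<in> L"
    have "\<exists>a\<in>A. dist a l < e \<and> dist p l \<le> d + e" if e: "0 < e" for e
    proof -
      have "0 < e / 2" using e by simp
      from lim[OF this] obtain B A' p' where B: "near (e / 2) B L" "B \<subseteq> A'" "near (e / 2) A' A"
        "p' \<in> B" "dist p p' < e / 2" "B \<subseteq> cball p' d" by blast
      then obtain b where b: "b \<in> B" "dist b l < e / 2" using l unfolding near_def by blast
      then obtain a where a: "a \<in> A" "dist b a < e / 2" using B unfolding near_def by blast
      have "dist p' b \<le> d" using B(6) b(1) by auto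
      then have "dist p l \<le> d + e"
        using b(2) B(5) dist_triangle[of p l p'] dist_triangle[of p' l b] by linarith
      moreover have "dist a l < e" using a(2) b(2) dist_triangle3[of a l b] by linarith
      ultimately show ?thesis using a(1) by blast
    qed
    then have "l \<in> closure A" "\<And>e. 0 < e \<Longrightarrow> dist p l \<le> d + e"
      by (auto simp: closure_approachable)
    then show "l \<in> A \<inter> cball p d" using A field_le_epsilon[of "dist p l" d] by simp
  qed
  \<comment> \<open>Each approximation provides its own point at distance nearly \<open>d\<close>; a
    point of \<open>L\<close> farthest from \<open>p\<close> serves all errors at once.\<close>
  have "continuous_on L (dist p)" by (intro continuous_intros)
  moreover have "L \<noteq> {}" using \<open>p \<in> L\<close> by blast
  ultimately obtain r where r: "r \<in> L" "\<And>l. l \<in> L \<Longrightarrow> dist p l \<le> dist p r"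
    using continuous_attains_sup[OF L] by blast
  have "d \<le> dist p r + e" if e: "0 < e" for e
  proof -
    have "0 < e / 2" using e by simp
    from lim[OF this] obtain B p' r' where B: "near (e / 2) B L"
      "p' \<in> B" "dist p p' < e / 2" "r' \<in> B" "d \<le> dist p' r'" by blast
    then obtain l where "l \<in> L" "dist r' l < e / 2" unfolding near_def by blast
    then show ?thesis
      using B r(2)[of l] dist_triangle3[of p' r' p] dist_triangle2[of p r' l] by linarith
  qed
  then have "d \<le> dist p r" by (rule field_le_epsilon)
  then show "\<exists>r\<in>L. d \<le> dist p r" using r(1) by blast
qed

text \<open>Let \<open>A\<close> be approximated by \<open>m\<close> disjoint members of
  \<open>F\<close>. Splitting each of them near \<open>p\<close> gives \<open>m\<close> nonempty
  disjoint pieces, and as \<open>m\<close> is arbitrary some limit of such pieces is crowded.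
  \<open>Q\<close> says that a set is such a piece up to error \<open>e\<close>.\<close>

lemma splittable_crowded:
  fixes X :: "'a::metric_space set"
  assumes X: "compact X" and F: "F \<subseteq> subcontinua X" and split: "splittable F"
  shows "splittable (crowded X F)"
  unfolding splittable_def
proof (intro ballI allI impI)
  fix A p d assume A: "A \<in> crowded X F" and p: "p \<in> A" and d: "0 < d" and "\<exists>q\<in>A. d < dist p q"
  then obtain q where q: "q \<in> A" "d < dist p q" by blast
  define Q where "Q e B \<longleftrightarrow> (\<exists>A'. B \<subseteq> A' \<and> near e A' A) \<and>
      (\<exists>p'\<in>B. dist p p' < e \<and> B \<subseteq> cball p' d \<and> (\<exists>r\<in>B. d \<le> dist p' r))" for e B
  have Q_mono: "Q e B" if "Q e' B" "e' \<le> e" for e e' B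
    using that unfolding Q_def by (meson near_mono less_le_trans)
  have "\<exists>D\<subseteq>F. finite D \<and> card D = m \<and> pairwise disjnt D \<and> (\<forall>B\<in>D. Q e B)" if e: "0 < e" for e m
  proof -
    \<comment> \<open>\<open>p\<close> and \<open>q\<close> move by less than \<open>e'\<close>
      each, which preserves the strict inequality \<open>d < dist p q\<close> required for splitting
      the approximant.\<close>
    define e' where "e' = min e ((dist p q - d) / 2)"
    have e': "0 < e'" "e' \<le> e" "2 * e' \<le> dist p q - d" using e q unfolding e'_def min_def by (auto simp: field_simps)
    obtain D where D: "D \<subseteq> F" "finite D" "card D = m" "pairwise disjnt D" "\<forall>B\<in>D. near e' B A"
      using A e'(1) unfolding crowded_def by blast
    have "\<exists>B\<in>F. B \<subseteq> A' \<and> B \<noteq> {} \<and> Q e B" if "A' \<in> D" for A'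
    proof -
      have n: "near e' A' A" using D that by blast
      obtain p' where p': "p' \<in> A'" "dist p' p < e'" using n p unfolding near_def by blast
      obtain q' where q': "q' \<in> A'" "dist q' q < e'" using n q(1) unfolding near_def by blast
      have "d < dist p' q'"
        using e'(3) p'(2) q'(2) dist_triangle3[of p q p'] dist_triangle[of p' q q'] by linarith
      moreover have "A' \<in> F" using D(1) that by blast
      ultimately obtain B r where B: "B \<in> F" "p' \<in> B" "B \<subseteq> A'" "B \<subseteq> cball p' d" "r \<in> B" "d \<le> dist p' r"
        using splittableD[OF split _ p'(1) q'(1) d] by metis
      have "dist p p' < e'" using p'(2) by (simp add: dist_commute)
      then have "Q e' B"
        unfolding Q_def using n B(2-6) by blast
      then have "Q e B" using e'(2) by (rule Q_mono)
      then show ?thesis using B(1-3) by blast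
    qed
    then obtain h where h: "\<And>A'. A' \<in> D \<Longrightarrow> h A' \<in> F \<and> h A' \<subseteq> A' \<and> h A' \<noteq> {} \<and> Q e (h A')"
      by metis
    have disj: "disjnt (h A1) (h A2)" if "A1 \<in> D" "A2 \<in> D" "A1 \<noteq> A2" for A1 A2
      using that D(4) h[OF that(1)] h[OF that(2)] unfolding pairwise_def disjnt_def by blast
    have "inj_on h D"
    proof (rule inj_onI, rule ccontr)
      fix A1 A2 assume *: "A1 \<in> D" "A2 \<in> D" "h A1 = h A2" "A1 \<noteq> A2"
      then show False using disj[of A1 A2] h[of A2] by (simp add: disjnt_def)
    qed
    then have "card (h ` D) = m" using D(3) by (simp add: card_image)
    moreover have "pairwise disjnt (h ` D)"
      using disj unfolding pairwise_def by blast
    ultimately show ?thesis using D(2) h by (intro exI[of _ "h ` D"]) auto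
  qed
  then have "\<exists>L\<in>crowded X F. \<forall>e>0. \<exists>B\<in>F. \<exists>c>0. c \<le> e \<and> Q c B \<and> near e B L"
    by (rule crowded_member_exists[OF X F])
  then obtain L where L: "L \<in> crowded X F"
      "\<forall>e>0. \<exists>B\<in>F. \<exists>c>0. c \<le> e \<and> Q c B \<and> near e B L"
    by (rule bexE)
  have lim: "\<exists>B. near e B L \<and> (\<exists>A'. B \<subseteq> A' \<and> near e A' A) \<and>
      (\<exists>p'\<in>B. dist p p' < e \<and> B \<subseteq> cball p' d \<and> (\<exists>r\<in>B. d \<le> dist p' r))" if e: "0 < e" for e
  proof -
    obtain B c where B: "c \<le> e" "Q c B" "near e B L" using L(2) e by blast
    have "Q e B" using B(2,1) by (rule Q_mono)
    then show ?thesis using B(3) unfolding Q_def by blast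
  qed
  have "compact L" "closed A"
    using L(1) A by (auto simp: crowded_def subcontinua_def continuum_def compact_imp_closed)
  note near_limit_in_cball[OF this lim]
  then show "\<exists>B\<in>crowded X F. p \<in> B \<and> B \<subseteq> A \<inter> cball p d \<and> (\<exists>r\<in>B. d \<le> dist p r)"
    using L(1) by blast
qed

text \<open>The piece is the component of \<open>p\<close> in \<open>A \<inter> cball p d\<close>.
  By boundary bumping it reaches the frontier of this set in \<open>A\<close>, which misses the open
  ball.\<close>

lemma splittable_subcontinua: "splittable (subcontinua X)"
  unfolding splittable_def
proof (intro ballI allI impI)
  fix A p d assume A: "A \<in> subcontinua X" and p: "p \<in> A" and d: "0 < d" and "\<exists>q\<in>A. d < dist p q"
  then obtain q where q: "q \<in> A" "d < dist p q" by blast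
  have A': "compact A" "connected A" "A \<subseteq> X" using A by (auto simp: subcontinua_def continuum_def)
  let ?T = "top_of_set A" and ?S = "A \<inter> cball p d"
  define B where "B = connected_component_set ?S p"
  have pS: "p \<in> ?S" using p d by simp
  have comp: "compact ?S" using A'(1) by (simp add: compact_Int_closed)
  have "closed B" unfolding B_def using comp by (intro closed_connected_component compact_imp_closed)
  moreover have BS: "B \<subseteq> ?S" unfolding B_def by (rule connected_component_subset)
  ultimately have "compact B" using comp compact_Int_closed[of ?S B] by (simp add: Int_absorb1)
  moreover have "connected B" unfolding B_def by (rule connected_connected_component)
  moreover have pB: "p \<in> B" unfolding B_def using pS by (simp add: connected_component_refl)
  ultimately have "B \<in> subcontinua X" using BS A'(3) by (auto simp: subcontinua_def continuum_def)
  moreover have "\<exists>r\<in>B. d \<le> dist p r"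
  proof -
    have sub: "subtopology ?T ?S = top_of_set ?S"
      by (simp add: subtopology_subtopology inf_absorb2)
    have "B \<inter> ?T frontier_of ?S \<noteq> {}"
    proof (rule boundary_bumping_theorem_closed)
      show "connected_space ?T" using A'(2) by (simp add: connected_space_subtopology)
      show "compact_space ?T" using A'(1) by (simp add: compact_space_subtopology)
      show "Hausdorff_space ?T" by (simp add: Hausdorff_space_subtopology)
      show "closedin ?T ?S" by (simp add: closedin_closed_Int)
      have "q \<notin> ?S" using q(2) by simp
      then show "?S \<noteq> topspace ?T" using q(1) by (metis topspace_euclidean_subtopology)
      show "B \<in> connected_components_of (subtopology ?T ?S)"
      proof -
        have "connected_component_of (top_of_set ?S) = connected_component ?S"
          by (intro ext) (simp add: connected_component_of_def connected_component_def connectedin_subtopology conj_assoc)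
        then show ?thesis
          using pS unfolding sub B_def connected_components_of_def by (simp del: Int_iff)
      qed
    qed
    then obtain r where r: "r \<in> B" "r \<in> ?T frontier_of ?S" by blast
    have "openin ?T (A \<inter> ball p d)" by (simp add: openin_open_Int)
    then have "A \<inter> ball p d \<subseteq> ?T interior_of ?S"
      by (intro interior_of_maximal) auto
    then have "r \<notin> A \<inter> ball p d" using r(2) by (auto simp: frontier_of_def)
    then show ?thesis using r(1) BS by (intro bexI[of _ r]) auto
  qed
  ultimately show "\<exists>B\<in>subcontinua X. p \<in> B \<and> B \<subseteq> ?S \<and> (\<exists>r\<in>B. d \<le> dist p r)"
    using pB BS by blast
qed

section \<open>A Cantor scheme of continua\<close>

definition nbhd :: "'a::metric_space set \<Rightarrow> real \<Rightarrow> 'a set" where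
  "nbhd A e = (\<Union>a\<in>A. ball a e)"

lemma in_nbhd_iff: "x \<in> nbhd A e \<longleftrightarrow> (\<exists>a\<in>A. dist a x < e)"
  by (simp add: nbhd_def)

lemma subset_nbhd: "0 < e \<Longrightarrow> A \<subseteq> nbhd A e"
  by (force simp: in_nbhd_iff)

lemma uncountable_nat_bool: "uncountable (UNIV :: (nat \<Rightarrow> bool) set)"
proof
  assume "countable (UNIV :: (nat \<Rightarrow> bool) set)"
  then obtain f :: "nat \<Rightarrow> nat \<Rightarrow> bool" where "range f = UNIV"
    using uncountable_def by blast
  then obtain n where "f n = (\<lambda>k. \<not> f k k)" by (metis rangeE UNIV_I)
  then show False by metis
qed

text \<open>One branching of the Cantor scheme: \<open>A\<close> is approximated by two disjoint
  members of \<open>F\<close>. They need not lie inside \<open>A\<close>, so only neighbourhoods are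
  nested; the doubled radius leaves room for passing to limits.\<close>

lemma crowded_split:
  fixes X :: "'a::metric_space set"
  assumes F: "F \<subseteq> crowded X F" and A: "A \<in> F" and e: "0 < e" and uv: "u \<in> A" "v \<in> A" "r < dist u v"
  shows "\<exists>B C d. B \<in> F \<and> C \<in> F \<and> 0 < d \<and> (\<exists>u\<in>B. \<exists>v\<in>B. r < dist u v) \<and> (\<exists>u\<in>C. \<exists>v\<in>C. r < dist u v)
    \<and> nbhd B (2 * d) \<subseteq> nbhd A e \<and> nbhd C (2 * d) \<subseteq> nbhd A e \<and> nbhd B d \<inter> nbhd C d = {}"
proof -
  \<comment> \<open>The second term bounds the movement of \<open>u\<close> and \<open>v\<close> so
    that their distance stays above \<open>r\<close>.\<close>
  define e1 where "e1 = min (e / 2) ((dist u v - r) / 2)"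
  have e1: "0 < e1" "e1 \<le> e / 2" "2 * e1 \<le> dist u v - r"
    using e uv unfolding e1_def min_def by (auto simp: field_simps)
  have "A \<in> crowded X F" using A F by blast
  then have "\<exists>D\<subseteq>F. finite D \<and> card D = 2 \<and> pairwise disjnt D \<and> (\<forall>B\<in>D. near e1 B A)"
    using e1(1) unfolding crowded_def by blast
  then obtain D where D: "D \<subseteq> F" "card D = 2" "pairwise disjnt D" "\<forall>B\<in>D. near e1 B A" by blast
  obtain B C where BC: "D = {B, C}" "B \<noteq> C" using D(2) by (auto simp: card_2_iff)
  then have BCF: "B \<in> F" "C \<in> F" using D(1) by auto
  have disj: "B \<inter> C = {}" using D(3) BC by (auto simp: pairwise_def disjnt_def)
  have "F \<subseteq> subcontinua X" using F by (auto simp: crowded_def)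
  then have "compact B" "closed C"
    using BCF by (auto simp: subcontinua_def continuum_def compact_imp_closed)
  then obtain s where s: "0 < s" "\<And>x y. x \<in> B \<Longrightarrow> y \<in> C \<Longrightarrow> s \<le> dist x y"
    using compact_closed_separation[OF _ _ disj] by metis
  \<comment> \<open>\<open>2 * d + e1 \<le> e\<close> gives the nesting,
    \<open>2 * d \<le> s\<close> the disjointness of the two neighbourhoods.\<close>
  define d where "d = min (e / 4) (s / 2)"
  have d: "0 < d" "2 * d \<le> e / 2" "2 * d \<le> s" using e s(1) by (auto simp: d_def)
  have far: "\<exists>u\<in>E. \<exists>v\<in>E. r < dist u v" if E: "near e1 E A" for E
  proof -
    obtain u' where u': "u' \<in> E" "dist u' u < e1" using E uv(1) by (auto simp: near_def)
    obtain v' where v': "v' \<in> E" "dist v' v < e1" using E uv(2) by (auto simp: near_def)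
    have "r < dist u' v'"
      using u' v' e1(3) dist_triangle3[of u v u'] dist_triangle[of u' v v'] by linarith
    then show ?thesis using u' v' by blast
  qed
  have sub: "nbhd E (2 * d) \<subseteq> nbhd A e" if E: "near e1 E A" for E
  proof
    fix x assume "x \<in> nbhd E (2 * d)"
    then obtain y where y: "y \<in> E" "dist y x < 2 * d" by (auto simp: in_nbhd_iff)
    then obtain a where a: "a \<in> A" "dist y a < e1" using E by (auto simp: near_def)
    have "dist a x < e" using y(2) a(2) d(2) e1(2) dist_triangle3[of a x y] by linarith
    then show "x \<in> nbhd A e" using a(1) by (auto simp: in_nbhd_iff)
  qed
  have "nbhd B d \<inter> nbhd C d = {}"
  proof (rule ccontr)
    assume "nbhd B d \<inter> nbhd C d \<noteq> {}"
    then obtain x b c where "b \<in> B" "c \<in> C" "dist b x < d" "dist c x < d"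
      by (auto simp: in_nbhd_iff)
    then show False using s(2)[of b c] d(3) dist_triangle2[of b c x] by linarith
  qed
  moreover have n: "near e1 B A" "near e1 C A" using D(4) BC by auto
  ultimately show ?thesis using BCF d(1) far[OF n(1)] far[OF n(2)] sub[OF n(1)] sub[OF n(2)]
    by (intro exI[of _ B] exI[of _ C] exI[of _ d] conjI)
qed

text \<open>Iterated branching assigns to every binary sequence a branch of continua of diameter
  above \<open>r\<close> with nested neighbourhoods. A cluster point along the branch stays in all
  these neighbourhoods, so different sequences have disjoint nondegenerate limits.\<close>

theorem crowded_family_not_suslinian:
  fixes X :: "'a::metric_space set"
  assumes X: "compact X" and F: "F \<subseteq> crowded X F"
    and A0: "A0 \<in> F" "u0 \<in> A0" "v0 \<in> A0" "u0 \<noteq> v0"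
  shows "\<exists>\<C>. uncountable \<C> \<and> pairwise disjnt \<C> \<and> (\<forall>C\<in>\<C>. C \<in> subcontinua X \<and> nondegenerate C)"
proof -
  define r where "r = dist u0 v0 / 2"
  have r: "0 < r" "r < dist u0 v0" using A0 by (auto simp: r_def)
  define P where "P s \<longleftrightarrow> fst s \<in> F \<and> 0 < snd s \<and> (\<exists>u\<in>fst s. \<exists>v\<in>fst s. r < dist u v)"
    for s :: "'a set \<times> real"
  have "\<exists>t. P s \<longrightarrow> (\<forall>b. P (t b) \<and> nbhd (fst (t b)) (2 * snd (t b)) \<subseteq> nbhd (fst s) (snd s))
      \<and> nbhd (fst (t True)) (snd (t True)) \<inter> nbhd (fst (t False)) (snd (t False)) = {}" for s
  proof (cases "P s")
    case True
    then obtain u v where "u \<in> fst s" "v \<in> fst s" "r < dist u v" "fst s \<in> F" "0 < snd s"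
      unfolding P_def by blast
    then obtain B C d where B: "B \<in> F" "C \<in> F" "0 < d" "\<exists>u\<in>B. \<exists>v\<in>B. r < dist u v"
        "\<exists>u\<in>C. \<exists>v\<in>C. r < dist u v" "nbhd B (2 * d) \<subseteq> nbhd (fst s) (snd s)"
        "nbhd C (2 * d) \<subseteq> nbhd (fst s) (snd s)" "nbhd B d \<inter> nbhd C d = {}"
      using crowded_split[OF F, of "fst s" "snd s" u v r] by blast
    show ?thesis
      by (rule exI[of _ "\<lambda>b. if b then (B, d) else (C, d)"]) (use B in \<open>simp add: P_def\<close>)
  qed simp
  then obtain t where t: "\<And>s. P s \<Longrightarrow> (\<forall>b. P (t s b) \<and> nbhd (fst (t s b)) (2 * snd (t s b)) \<subseteq> nbhd (fst s) (snd s))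
      \<and> nbhd (fst (t s True)) (snd (t s True)) \<inter> nbhd (fst (t s False)) (snd (t s False)) = {}"
    by metis
  \<comment> \<open>The state reached along \<open>x\<close> is a continuum with a radius; the
    initial radius 1 is arbitrary.\<close>
  define node where "node x = rec_nat (A0, 1) (\<lambda>n s. t s (x n))" for x :: "nat \<Rightarrow> bool"
  have node_0: "node x 0 = (A0, 1)" and node_Suc: "node x (Suc n) = t (node x n) (x n)" for x n
    by (simp_all add: node_def)
  define N where "N x n = nbhd (fst (node x n)) (snd (node x n))" for x n
  have P_node: "P (node x n)" for x n
  proof (induction n)
    case 0
    then show ?case using A0 r(2) by (auto simp: node_0 P_def)
  next
    case (Suc n)
    then show ?case using t by (simp add: node_Suc)
  qed
  have shrink: "nbhd (fst (node x (Suc n))) (2 * snd (node x (Suc n))) \<subseteq> N x n" for x n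
    using t[OF P_node[of x n]] by (simp add: node_Suc N_def)
  have decr: "N x n \<subseteq> N x m" if "m \<le> n" for x m n
  proof -
    have "N x (Suc k) \<subseteq> N x k" for k
    proof -
      have "0 < snd (node x (Suc k))" using P_node[of x "Suc k"] by (simp add: P_def)
      then have "N x (Suc k) \<subseteq> nbhd (fst (node x (Suc k))) (2 * snd (node x (Suc k)))"
        unfolding N_def by (force simp: in_nbhd_iff)
      then show ?thesis using shrink by blast
    qed
    then show ?thesis using that by (rule lift_Suc_antimono_le)
  qed
  have Fsub: "F \<subseteq> subcontinua X" using F by (auto simp: crowded_def)
  have "\<exists>L\<in>subcontinua X. \<forall>e>0. \<exists>\<^sub>F n in sequentially. near e (fst (node x n)) L" for x
  proof -
    have "\<forall>\<^sub>F n in sequentially. fst (node x n) \<in> subcontinua X"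
      using P_node Fsub by (intro always_eventually) (auto simp: P_def)
    then obtain L where "L \<in> subcontinua X"
      "\<And>e. 0 < e \<Longrightarrow> \<exists>\<^sub>F n in sequentially. near e (fst (node x n)) L"
      using subcontinua_cluster_point[OF X sequentially_bot] by metis
    then show ?thesis by blast
  qed
  then obtain L where L: "\<And>x. L x \<in> subcontinua X"
    "\<And>x e. 0 < e \<Longrightarrow> \<exists>\<^sub>F n in sequentially. near e (fst (node x n)) (L x)"
    by metis
  \<comment> \<open>A point of the limit is within \<open>?e\<close> of a late node, which in turn
    is within \<open>?e\<close> of node \<open>Suc n\<close>. This places it in the doubled
    neighbourhood, which lies in \<open>N x n\<close>.\<close>
  have LN: "L x \<subseteq> N x n" for x n
  proof
    fix l assume l: "l \<in> L x"
    let ?e = "snd (node x (Suc n))"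
    have e: "0 < ?e" using P_node[of x "Suc n"] by (simp add: P_def)
    then obtain m where m: "m \<ge> Suc n" "near ?e (fst (node x m)) (L x)"
      using L(2) unfolding frequently_sequentially by blast
    then obtain a where a: "a \<in> fst (node x m)" "dist a l < ?e" using l by (auto simp: near_def)
    have "0 < snd (node x m)" using P_node[of x m] by (simp add: P_def)
    then have "a \<in> N x m" using a(1) subset_nbhd unfolding N_def by blast
    then have "a \<in> N x (Suc n)" using decr[OF m(1)] by blast
    then obtain b where b: "b \<in> fst (node x (Suc n))" "dist b a < ?e"
      by (auto simp: N_def in_nbhd_iff)
    have "dist b l < 2 * ?e" using a(2) b(2) dist_triangle[of b l a] by linarith
    then have "l \<in> nbhd (fst (node x (Suc n))) (2 * ?e)" using b(1) by (auto simp: in_nbhd_iff)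
    then show "l \<in> N x n" using shrink[of x n] by blast
  qed
  have disj: "L x \<inter> L y = {}" if "x \<noteq> y" for x y
  proof -
    \<comment> \<open>Up to the first difference the two branches share their nodes; there they
      enter disjoint neighbourhoods.\<close>
    define n where "n = (LEAST n. x n \<noteq> y n)"
    have "\<exists>n. x n \<noteq> y n" using that by auto
    then have n: "x n \<noteq> y n" unfolding n_def by (rule LeastI_ex)
    have "node x k = node y k" if "k \<le> n" for k
      using that
    proof (induction k)
      case (Suc k)
      then have "x k = y k" using not_less_Least[of k "\<lambda>n. x n \<noteq> y n"] unfolding n_def by simp
      then show ?case using Suc by (simp add: node_Suc)
    qed (simp add: node_0)
    then have eq: "node x n = node y n" by simp
    have "N x (Suc n) \<inter> N y (Suc n) = {}"
      using t[OF P_node[of x n]] n eq unfolding N_def node_Suc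
      by (cases "x n"; cases "y n") (auto simp: Int_commute)
    then show ?thesis using LN by blast
  qed
  have nondeg: "nondegenerate (L x)" for x
  proof -
    have "0 < r / 2" using r(1) by simp
    then have "\<exists>\<^sub>F n in sequentially. near (r / 2) (fst (node x n)) (L x)" by (rule L(2))
    then obtain n where n: "near (r / 2) (fst (node x n)) (L x)"
      unfolding frequently_sequentially by blast
    obtain u v where uv: "u \<in> fst (node x n)" "v \<in> fst (node x n)" "r < dist u v"
      using P_node[of x n] unfolding P_def by blast
    have "\<exists>x1\<in>L x. \<exists>x2\<in>L x. x1 \<noteq> x2" by (rule near_imp_nontrivial[OF n uv])
    then show ?thesis by (auto simp: nondegenerate_def)
  qed
  have "inj L"
  proof (rule injI, rule ccontr)
    fix x y assume "L x = L y" "x \<noteq> y"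
    then show False using disj[of x y] L(1)[of y] by (auto simp: subcontinua_def continuum_def)
  qed
  then have "uncountable (range L)"
    using uncountable_nat_bool countable_image_inj_on by blast
  moreover have "pairwise disjnt (range L)"
  proof (rule pairwiseI)
    fix C D assume "C \<in> range L" "D \<in> range L" "C \<noteq> D"
    then obtain x y where "C = L x" "D = L y" "x \<noteq> y" by auto
    then show "disjnt C D" using disj by (simp add: disjnt_def)
  qed
  ultimately show ?thesis using L(1) nondeg by (intro exI[of _ "range L"]) auto
qed

section \<open>Expansive actions\<close>

text \<open>A member with property \<open>R\<close> is chosen from each family, and a cluster point
  is taken along the filter of smaller and smaller families of the chain. Beyond a given
  \<open>F\<close> all chosen continua belong to \<open>F\<close>, so by closedness the cluster
  point does as well. The filter replaces a sequence because a chain may have no countable cofinal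
  part.\<close>

lemma chain_cluster_point:
  fixes X :: "'a::metric_space set"
  assumes X: "compact X" and C: "C \<noteq> {}" "\<forall>F\<in>C. near_closed X F"
    "\<forall>F\<in>C. \<forall>F'\<in>C. F \<subseteq> F' \<or> F' \<subseteq> F"
    and R: "\<forall>F\<in>C. \<exists>A\<in>F. R A"
  shows "\<exists>L\<in>\<Inter>C. \<forall>e>0. \<exists>A. R A \<and> near e A L"
proof -
  from R obtain a where a: "\<And>F. F \<in> C \<Longrightarrow> a F \<in> F \<and> R (a F)" by metis
  define \<Phi> where "\<Phi> = (INF F\<in>C. principal {F' \<in> C. F' \<subseteq> F})"
  have ev: "eventually P \<Phi> \<longleftrightarrow> (\<exists>F\<in>C. \<forall>F'\<in>C. F' \<subseteq> F \<longrightarrow> P F')" for P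
  proof -
    have "\<exists>H\<in>C. principal {F' \<in> C. F' \<subseteq> H} \<le> inf (principal {F' \<in> C. F' \<subseteq> F}) (principal {F' \<in> C. F' \<subseteq> F1})"
      if "F \<in> C" "F1 \<in> C" for F F1
    proof (cases "F \<subseteq> F1")
      case True
      then show ?thesis using that(1) by (intro bexI[of _ F]) auto
    next
      case False
      then have "F1 \<subseteq> F" using C(3) that by blast
      then show ?thesis using that(2) by (intro bexI[of _ F1]) auto
    qed
    then show ?thesis
      unfolding \<Phi>_def by (subst eventually_INF_base[OF C(1)]) (simp_all add: eventually_principal Ball_def imp_conjL)
  qed
  have "\<Phi> \<noteq> bot" unfolding trivial_limit_def ev by blast
  moreover have "\<forall>\<^sub>F F in \<Phi>. a F \<in> subcontinua X"
    unfolding ev using C(1,2) a near_closed_subset by blast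
  ultimately obtain L where L: "L \<in> subcontinua X" "\<And>e. 0 < e \<Longrightarrow> \<exists>\<^sub>F F in \<Phi>. near e (a F) L"
    using subcontinua_cluster_point[OF X] by metis
  have below: "\<exists>F'\<in>C. F' \<subseteq> F \<and> near e (a F') L" if F: "F \<in> C" and e: "0 < e" for F e
  proof (rule ccontr)
    assume "\<not> ?thesis"
    then have "\<forall>\<^sub>F F in \<Phi>. \<not> near e (a F) L" unfolding ev using F by blast
    then show False using L(2)[OF e] by (simp add: frequently_def)
  qed
  have "L \<in> F" if F: "F \<in> C" for F
  proof (rule near_closedD[of X])
    show "near_closed X F" "L \<in> subcontinua X" using C(2) F L(1) by blast+

    fix e :: real assume "0 < e"
    then obtain F' where "F' \<in> C" "F' \<subseteq> F" "near e (a F') L" using below[OF F] by blast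
    then show "\<exists>A\<in>F. near e A L" using a by blast
  qed
  moreover have "\<exists>A. R A \<and> near e A L" if e: "0 < e" for e
  proof -
    obtain F where "F \<in> C" using C(1) by blast
    then obtain F' where "F' \<in> C" "near e (a F') L" using below e by blast
    then show ?thesis using a by blast
  qed
  ultimately show ?thesis by blast
qed

lemma near_closed_Inter:
  assumes "C \<noteq> {}" "\<forall>F\<in>C. near_closed X F"
  shows "near_closed X (\<Inter>C)"
  unfolding near_closed_def
proof (intro conjI ballI impI InterI)
  show "\<Inter>C \<subseteq> subcontinua X" using assms near_closed_subset by blast
next
  fix L F assume L: "L \<in> subcontinua X" "\<forall>e>0. \<exists>A\<in>\<Inter>C. near e A L" and F: "F \<in> C"
  show "L \<in> F"
  proof (rule near_closedD[of X])
    show "near_closed X F" "L \<in> subcontinua X" using assms(2) F L(1) by blast+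
    show "\<exists>A\<in>F. near e A L" if "0 < e" for e using L(2) F that by blast
  qed
qed

text \<open>The families of the chain may offer different pieces of \<open>A\<close>. A cluster
  point of them lies in every family and is again a piece, by \<open>near_limit_in_cball\<close>
  with \<open>A' = A\<close> and \<open>p' = p\<close>.\<close>

lemma splittable_Inter:
  fixes X :: "'a::metric_space set"
  assumes X: "compact X" and C: "C \<noteq> {}" "\<forall>F\<in>C. near_closed X F"
    "\<forall>F\<in>C. \<forall>F'\<in>C. F \<subseteq> F' \<or> F' \<subseteq> F"
    and split: "\<forall>F\<in>C. splittable F"
  shows "splittable (\<Inter>C)"
  unfolding splittable_def
proof (intro ballI allI impI)
  fix A p d assume A: "A \<in> \<Inter>C" and p: "p \<in> A" and d: "0 < d" and "\<exists>q\<in>A. d < dist p q"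
  then obtain q where q: "q \<in> A" "d < dist p q" by blast
  define R where "R B \<longleftrightarrow> p \<in> B \<and> B \<subseteq> A \<and> B \<subseteq> cball p d \<and> (\<exists>r\<in>B. d \<le> dist p r)" for B
  have "\<exists>B\<in>F. R B" if F: "F \<in> C" for F
  proof -
    have "A \<in> F" using A F by blast
    then obtain B r where "B \<in> F" "p \<in> B" "B \<subseteq> A" "B \<subseteq> cball p d" "r \<in> B" "d \<le> dist p r"
      using splittableD[OF bspec[OF split F] _ p q(1) d q(2)] by metis
    then show ?thesis unfolding R_def by blast
  qed
  then obtain L where L: "L \<in> \<Inter>C" "\<forall>e>0. \<exists>B. R B \<and> near e B L"
    using chain_cluster_point[OF X C, of R] by auto
  obtain F where F: "F \<in> C" using C(1) by blast
  then have "F \<subseteq> subcontinua X" using C(2) near_closed_subset by blast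
  then have "compact L" "closed A"
    using L(1) A F by (auto simp: subcontinua_def continuum_def compact_imp_closed)
  moreover have "\<exists>B. near e B L \<and> (\<exists>A'. B \<subseteq> A' \<and> near e A' A) \<and>
      (\<exists>p'\<in>B. dist p p' < e \<and> B \<subseteq> cball p' d \<and> (\<exists>r\<in>B. d \<le> dist p' r))" if e: "0 < e" for e
  proof -
    obtain B where B: "R B" "near e B L" using L(2) e by blast
    have "dist p p < e" using e by simp
    then show ?thesis using B near_refl[OF e, of A] unfolding R_def by blast
  qed
  note near_limit_in_cball[OF calculation this]
  then show "\<exists>B\<in>\<Inter>C. p \<in> B \<and> B \<subseteq> A \<inter> cball p d \<and> (\<exists>r\<in>B. d \<le> dist p r)"
    using L(1) by blast
qed

lemma polynomial_less_exponential: "\<exists>n. M * (n + 2) ^ k < (2::nat) ^ n"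
proof -
  have "\<forall>\<^sub>F n in at_top. real M * (real n + 2) ^ k < 2 ^ n" by real_asymp
  then obtain n where "real M * (real n + 2) ^ k < 2 ^ n"
    using eventually_happens'[OF sequentially_bot] by blast
  then have "real (M * (n + 2) ^ k) < real (2 ^ n)" by (simp add: add.commute)
  then show ?thesis by (intro exI[of _ n]) (simp only: of_nat_less_iff)
qed

section \<open>The induced action on subcontinua\<close>

locale homeo_action = group G for G :: "('g, 'm) monoid_scheme" (structure) +
  fixes X :: "'a::metric_space set" and \<phi> :: "'g \<Rightarrow> 'a \<Rightarrow> 'a"
  assumes compact: "compact X" and action: "continuous_action G X \<phi>"
begin

lemma act_homeomorphism: "g \<in> carrier G \<Longrightarrow> \<phi> g \<in> Bij X \<and> (\<exists>h. homeomorphism X X (\<phi> g) h)"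
  using action by (auto simp: continuous_action_def hom_def HomeoGroup_def)

lemma act_continuous: "g \<in> carrier G \<Longrightarrow> continuous_on X (\<phi> g)"
  using act_homeomorphism homeomorphism_cont1 by blast

lemma act_image: "g \<in> carrier G \<Longrightarrow> \<phi> g ` X = X"
  using act_homeomorphism homeomorphism_image1 by blast

lemma act_in: "g \<in> carrier G \<Longrightarrow> x \<in> X \<Longrightarrow> \<phi> g x \<in> X"
  using act_image by blast

lemma act_inj: "g \<in> carrier G \<Longrightarrow> inj_on (\<phi> g) X"
  using act_homeomorphism by (auto simp: Bij_def bij_betw_def)

lemma act_mult:
  assumes "g \<in> carrier G" "h \<in> carrier G" "x \<in> X"
  shows "\<phi> (g \<otimes> h) x = \<phi> g (\<phi> h x)"
proof -
  have "\<phi> (g \<otimes> h) = \<phi> g \<otimes>\<^bsub>HomeoGroup X\<^esub> \<phi> h"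
    using action assms by (auto simp: continuous_action_def hom_def)
  also have "\<dots> = compose X (\<phi> g) (\<phi> h)"
    using act_homeomorphism assms by (simp add: HomeoGroup_def BijGroup_def)
  finally show ?thesis using assms(3) by (simp add: compose_def)
qed

lemma act_one:
  assumes "x \<in> X"
  shows "\<phi> \<one> x = x"
proof -
  \<comment> \<open>An injective idempotent map is the identity.\<close>
  have "\<phi> \<one> (\<phi> \<one> x) = \<phi> \<one> x" using act_mult[of \<one> \<one> x] assms by simp
  then show ?thesis using act_inj[of \<one>] act_in[of \<one>] assms by (auto simp: inj_on_def)
qed

lemma act_inv: "g \<in> carrier G \<Longrightarrow> x \<in> X \<Longrightarrow> \<phi> (inv g) (\<phi> g x) = x"
  using act_mult[of "inv g" g x] act_one by simp

lemma image_subcontinua: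
  assumes "g \<in> carrier G" "A \<in> subcontinua X"
  shows "\<phi> g ` A \<in> subcontinua X"
proof -
  have A: "A \<subseteq> X" "A \<noteq> {}" "compact A" "connected A"
    using assms(2) by (auto simp: subcontinua_def continuum_def)
  moreover from this have "continuous_on A (\<phi> g)"
    using act_continuous[OF assms(1)] continuous_on_subset by blast
  ultimately show ?thesis using act_in[OF assms(1)]
    by (auto simp: subcontinua_def continuum_def compact_continuous_image connected_continuous_image)
qed

lemma near_image:
  assumes "g \<in> carrier G" "0 < e"
  obtains d where "0 < d" "\<And>A B. A \<subseteq> X \<Longrightarrow> B \<subseteq> X \<Longrightarrow> near d A B \<Longrightarrow> near e (\<phi> g ` A) (\<phi> g ` B)"
proof -
  have "uniformly_continuous_on X (\<phi> g)"
    using compact act_continuous[OF assms(1)] by (intro compact_uniformly_continuous)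
  then obtain d where d: "0 < d" "\<forall>x\<in>X. \<forall>y\<in>X. dist y x < d \<longrightarrow> dist (\<phi> g y) (\<phi> g x) < e"
    using assms(2) unfolding uniformly_continuous_on_def by blast
  have half: "\<exists>b'\<in>\<phi> g ` B. dist a' b' < e"
    if AB: "A \<subseteq> X" "B \<subseteq> X" "near d A B" "a' \<in> \<phi> g ` A" for A B a'
  proof -
    obtain a where a: "a \<in> A" "a' = \<phi> g a" using AB(4) by blast
    obtain b where b: "b \<in> B" "dist a b < d" using AB(3) a(1) unfolding near_def by metis
    have "a \<in> X" "b \<in> X" using AB(1,2) a b by auto
    then have "dist a' (\<phi> g b) < e" using d(2) a(2) b(2) by simp
    then show ?thesis using b(1) by blast
  qed
  have "near e (\<phi> g ` A) (\<phi> g ` B)" if AB: "A \<subseteq> X" "B \<subseteq> X" "near d A B" for A B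
    unfolding near_def
  proof (intro conjI ballI)
    show "\<exists>b'\<in>\<phi> g ` B. dist a' b' < e" if "a' \<in> \<phi> g ` A" for a'
      by (rule half[OF AB that])
    show "\<exists>a'\<in>\<phi> g ` A. dist a' b' < e" if "b' \<in> \<phi> g ` B" for b'
      using half[OF AB(2,1) near_sym[OF AB(3)] that] by (simp add: dist_commute)
  qed
  then show thesis using d(1) that by blast
qed

definition invariant :: "'a set set \<Rightarrow> bool" where
  "invariant F \<longleftrightarrow> (\<forall>g\<in>carrier G. \<forall>A\<in>F. \<phi> g ` A \<in> F)"

lemma inj_on_image_act: "g \<in> carrier G \<Longrightarrow> D \<subseteq> Pow X \<Longrightarrow> inj_on ((`) (\<phi> g)) D"
  using inj_on_image_Pow[OF act_inj] inj_on_subset by blast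

lemma pairwise_disjnt_image_act:
  assumes g: "g \<in> carrier G" and D: "D \<subseteq> Pow X" "pairwise disjnt D"
  shows "pairwise disjnt ((`) (\<phi> g) ` D)"
proof (rule pairwiseI)
  fix A' B' assume "A' \<in> (`) (\<phi> g) ` D" "B' \<in> (`) (\<phi> g) ` D" "A' \<noteq> B'"
  then obtain A B where AB: "A \<in> D" "B \<in> D" "A' = \<phi> g ` A" "B' = \<phi> g ` B" "A \<noteq> B" by blast
  then have "A \<inter> B = {}" using D(2) by (auto simp: pairwise_def disjnt_def)
  moreover have "\<phi> g ` (A \<inter> B) = \<phi> g ` A \<inter> \<phi> g ` B"
    using AB D(1) by (intro inj_on_image_Int[OF act_inj[OF g]]) auto
  ultimately show "disjnt A' B'" using AB by (simp add: disjnt_def)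
qed

lemma invariant_crowded:
  assumes F: "F \<subseteq> subcontinua X" and inv: "invariant F"
  shows "invariant (crowded X F)"
  unfolding invariant_def
proof (intro ballI)
  fix g A assume g: "g \<in> carrier G" and A: "A \<in> crowded X F"
  have AX: "A \<in> subcontinua X" using A by (simp add: crowded_def)
  have "\<exists>D\<subseteq>F. finite D \<and> card D = m \<and> pairwise disjnt D \<and> (\<forall>B\<in>D. near e B (\<phi> g ` A))" if e: "0 < e" for e m
  proof -
    obtain d where d: "0 < d" "\<And>A B. A \<subseteq> X \<Longrightarrow> B \<subseteq> X \<Longrightarrow> near d A B \<Longrightarrow> near e (\<phi> g ` A) (\<phi> g ` B)"
      using near_image[OF g e] by metis
    obtain D where D: "D \<subseteq> F" "finite D" "card D = m" "pairwise disjnt D" "\<forall>B\<in>D. near d B A"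
      using A d(1) unfolding crowded_def by blast
    have DX: "D \<subseteq> Pow X" using D(1) F by (auto simp: subcontinua_def)
    have "card ((`) (\<phi> g) ` D) = m"
      using D(3) card_image[OF inj_on_image_act[OF g DX]] by simp
    moreover have "(`) (\<phi> g) ` D \<subseteq> F" using inv g D(1) by (auto simp: invariant_def)
    moreover have "\<forall>B\<in>(`) (\<phi> g) ` D. near e B (\<phi> g ` A)"
      using D(5) d(2) DX AX by (auto simp: subcontinua_def)
    ultimately show ?thesis
      using D(2) pairwise_disjnt_image_act[OF g DX D(4)] by (intro exI[of _ "(`) (\<phi> g) ` D"]) auto
  qed
  then show "\<phi> g ` A \<in> crowded X F"
    using image_subcontinua[OF g AX] by (simp add: crowded_def)
qed

text \<open>The last clause keeps a minimal family from consisting of points only.\<close>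

definition admissible :: "'a set set \<Rightarrow> bool" where
  "admissible F \<longleftrightarrow> near_closed X F \<and> invariant F \<and> splittable F \<and> (\<exists>A\<in>F. \<exists>x\<in>A. \<exists>y\<in>A. x \<noteq> y)"

end

section \<open>Minimal admissible families\<close>

locale expansive_homeo_action = homeo_action G X \<phi>
  for G :: "('g, 'm) monoid_scheme" (structure) and X :: "'a::metric_space set" and \<phi> +
  fixes c :: real
  assumes c_pos: "0 < c"
    and expansive: "\<And>x y. x \<in> X \<Longrightarrow> y \<in> X \<Longrightarrow> x \<noteq> y \<Longrightarrow> \<exists>g\<in>carrier G. c < dist (\<phi> g x) (\<phi> g y)"
begin

text \<open>Expansiveness and invariance turn mere nontriviality into the uniform bound
  \<open>c\<close>, which is what survives in limits.\<close>

lemma admissible_large_member: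
  assumes "admissible F"
  shows "\<exists>A\<in>F. \<exists>x\<in>A. \<exists>y\<in>A. c < dist x y"
proof -
  obtain A x y where A: "A \<in> F" "x \<in> A" "y \<in> A" "x \<noteq> y"
    using assms unfolding admissible_def by blast
  have "F \<subseteq> subcontinua X" using assms by (simp add: admissible_def near_closed_subset)
  then have "x \<in> X" "y \<in> X" using A by (auto simp: subcontinua_def)
  then obtain g where g: "g \<in> carrier G" "c < dist (\<phi> g x) (\<phi> g y)" using expansive A(4) by blast
  moreover have "\<phi> g ` A \<in> F" using assms A(1) g(1) by (auto simp: admissible_def invariant_def)
  ultimately show ?thesis using A(2,3) by (intro bexI[of _ "\<phi> g ` A"] bexI[of _ "\<phi> g x"] bexI[of _ "\<phi> g y"]) auto
qed

text \<open>The delicate clause is nontriviality: the members of diameter above \<open>c\<close>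
  found in each family cluster at a nontrivial continuum common to all of them.\<close>

lemma admissible_Inter:
  assumes C: "C \<noteq> {}" "\<forall>F\<in>C. admissible F" "\<forall>F\<in>C. \<forall>F'\<in>C. F \<subseteq> F' \<or> F' \<subseteq> F"
  shows "admissible (\<Inter>C)"
proof -
  have nc: "\<forall>F\<in>C. near_closed X F" and sp: "\<forall>F\<in>C. splittable F" and iv: "\<forall>F\<in>C. invariant F"
    using C(2) by (auto simp: admissible_def)
  have "\<exists>L\<in>\<Inter>C. \<forall>e>0. \<exists>A. (\<exists>x\<in>A. \<exists>y\<in>A. c < dist x y) \<and> near e A L"
    using C(2) admissible_large_member by (intro chain_cluster_point[OF compact C(1) nc C(3)]) auto
  then obtain L where L: "L \<in> \<Inter>C" "\<forall>e>0. \<exists>A. (\<exists>x\<in>A. \<exists>y\<in>A. c < dist x y) \<and> near e A L" by blast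
  have "0 < c / 2" using c_pos by simp
  then obtain A x y where "x \<in> A" "y \<in> A" "c < dist x y" "near (c / 2) A L" using L(2) by blast
  then have "\<exists>x\<in>L. \<exists>y\<in>L. x \<noteq> y" using near_imp_nontrivial by blast
  moreover have "invariant (\<Inter>C)" using iv by (auto simp: invariant_def)
  ultimately show ?thesis
    unfolding admissible_def
    using L(1) near_closed_Inter[OF C(1) nc] splittable_Inter[OF compact C(1) nc C(3) sp] by blast
qed

lemma minimal_admissible:
  assumes "admissible F0"
  obtains F where "admissible F" "\<And>F'. admissible F' \<Longrightarrow> F' \<subseteq> F \<Longrightarrow> F' = F"
proof -
  have "\<exists>F\<in>Collect admissible. \<forall>F'\<in>Collect admissible. F' \<subseteq> F \<longrightarrow> F' = F"
  proof (rule predicate_Zorn[of "Collect admissible" "\<lambda>F F'. F' \<subseteq> F"])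
    show "partial_order_on (Collect admissible) (relation_of (\<lambda>F F'. F' \<subseteq> F) (Collect admissible))"
      by (rule partial_order_on_relation_ofI) auto
  next
    fix C assume "C \<in> Chains (relation_of (\<lambda>F F'. F' \<subseteq> F) (Collect admissible))"
    then have C: "\<forall>F\<in>C. admissible F" "\<forall>F\<in>C. \<forall>F'\<in>C. F \<subseteq> F' \<or> F' \<subseteq> F"
      by (auto simp: Chains_def relation_of_def)
    show "\<exists>H\<in>Collect admissible. \<forall>F\<in>C. H \<subseteq> F"
    proof (cases "C = {}")
      case True
      then show ?thesis using assms by auto
    next
      case False
      then show ?thesis using admissible_Inter[OF False C] by (intro bexI[of _ "\<Inter>C"]) auto
    qed
  qed
  then show thesis using that by auto
qed

lemma admissible_subcontinua:
  assumes "continuum X" "nondegenerate X"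
  shows "admissible (subcontinua X)"
proof -
  have X: "X \<in> subcontinua X" using assms(1) by (simp add: subcontinua_def)
  obtain x where x: "x \<in> X" using assms(1) by (auto simp: continuum_def)
  then have "X \<noteq> {x}" using assms(2) by (auto simp: nondegenerate_def)
  then obtain y where "y \<in> X" "x \<noteq> y" using x by blast
  then have "\<exists>A\<in>subcontinua X. \<exists>x\<in>A. \<exists>y\<in>A. x \<noteq> y" using X x by blast
  then show ?thesis
    using splittable_subcontinua image_subcontinua
    by (simp add: admissible_def near_closed_def invariant_def)
qed

section \<open>Exponential splitting against bounded multiplicity\<close>

text \<open>The pairs at distance at least \<open>d\<close> form a compact set, and the pairs
  expanded by a given \<open>g\<close> are open in it; \<open>E\<close> comes from a finite
  subcover.\<close>

lemma uniform_expansivity: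
  assumes "0 < d"
  obtains E where "finite E" "E \<subseteq> carrier G"
    "\<forall>x\<in>X. \<forall>y\<in>X. d \<le> dist x y \<longrightarrow> (\<exists>g\<in>E. c < dist (\<phi> g x) (\<phi> g y))"
proof -
  define K where "K = (X \<times> X) \<inter> {z. d \<le> dist (fst z) (snd z)}"
  have "closed {z :: 'a \<times> 'a. d \<le> dist (fst z) (snd z)}"
    by (intro closed_Collect_le continuous_intros)
  then have K: "compact K"
    unfolding K_def using compact by (intro compact_Int_closed compact_Times)
  define T where "T g = {z \<in> K. c < dist (\<phi> g (fst z)) (\<phi> g (snd z))}" for g
  have op: "openin (top_of_set K) (T g)" if g: "g \<in> carrier G" for g
  proof -
    have "fst ` K \<subseteq> X" "snd ` K \<subseteq> X" by (auto simp: K_def)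
    then have 1: "continuous_on K (\<lambda>z. \<phi> g (fst z))" "continuous_on K (\<lambda>z. \<phi> g (snd z))"
      by (simp_all add: continuous_on_compose2[OF act_continuous[OF g]] continuous_on_fst continuous_on_snd)
    have "continuous_on K (\<lambda>z. dist (\<phi> g (fst z)) (\<phi> g (snd z)))"
      using 1 by (rule continuous_on_dist)
    then have "openin (top_of_set K) (K \<inter> (\<lambda>z. dist (\<phi> g (fst z)) (\<phi> g (snd z))) -` {c<..})"
      by (rule continuous_openin_preimage_gen) simp
    moreover have "K \<inter> (\<lambda>z. dist (\<phi> g (fst z)) (\<phi> g (snd z))) -` {c<..} = T g"
      by (auto simp: T_def)
    ultimately show ?thesis by simp
  qed
  have cover: "K \<subseteq> \<Union>(T ` carrier G)"
  proof
    fix z assume z: "z \<in> K"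
    then have "fst z \<in> X" "snd z \<in> X" "fst z \<noteq> snd z" using assms by (auto simp: K_def)
    then obtain g where "g \<in> carrier G" "c < dist (\<phi> g (fst z)) (\<phi> g (snd z))" using expansive by blast
    then show "z \<in> \<Union>(T ` carrier G)" using z by (auto simp: T_def)
  qed
  have "(\<forall>U\<in>T ` carrier G. openin (top_of_set K) U) \<and> K \<subseteq> \<Union>(T ` carrier G)"
    using op cover by simp
  then have "\<exists>\<D>\<subseteq>T ` carrier G. finite \<D> \<and> K \<subseteq> \<Union>\<D>"
    by (rule compact_eq_openin_cover[THEN iffD1, OF K, THEN spec, THEN mp])
  then obtain E where E: "E \<subseteq> carrier G" "finite E" "K \<subseteq> \<Union>(T ` E)"
    by (metis finite_subset_image)
  have "\<exists>g\<in>E. c < dist (\<phi> g x) (\<phi> g y)" if "x \<in> X" "y \<in> X" "d \<le> dist x y" for x y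
  proof -
    have "(x, y) \<in> K" using that by (simp add: K_def)
    then have "(x, y) \<in> \<Union>(T ` E)" using E(3) by blast
    then show ?thesis by (auto simp: T_def)
  qed
  then show thesis by (intro that[OF E(2,1)]) blast
qed

text \<open>Otherwise arbitrarily many disjoint members of diameter above \<open>c\<close> would
  exist, and \<open>crowded_member_exists\<close> with \<open>Q\<close> independent of the error
  would produce a nontrivial crowded continuum.\<close>

lemma large_members_bounded:
  assumes F: "F \<subseteq> subcontinua X" and triv: "\<And>A x y. A \<in> crowded X F \<Longrightarrow> x \<in> A \<Longrightarrow> y \<in> A \<Longrightarrow> x = y"
  obtains M :: nat where "\<forall>D\<subseteq>F. finite D \<longrightarrow> pairwise disjnt D \<longrightarrow>
    (\<forall>A\<in>D. \<exists>x\<in>A. \<exists>y\<in>A. c < dist x y) \<longrightarrow> card D \<le> M"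
proof -
  have "\<exists>M. \<forall>D\<subseteq>F. finite D \<longrightarrow> pairwise disjnt D \<longrightarrow> (\<forall>A\<in>D. \<exists>x\<in>A. \<exists>y\<in>A. c < dist x y) \<longrightarrow> card D \<le> M"
  proof (rule ccontr)
    assume "\<not> ?thesis"
    then have unb: "\<exists>D\<subseteq>F. finite D \<and> pairwise disjnt D \<and> (\<forall>A\<in>D. \<exists>x\<in>A. \<exists>y\<in>A. c < dist x y) \<and> m < card D" for m
      by (metis not_le)
    have "\<exists>D\<subseteq>F. finite D \<and> card D = m \<and> pairwise disjnt D \<and> (\<forall>A\<in>D. \<exists>x\<in>A. \<exists>y\<in>A. c < dist x y)" for m
    proof -
      obtain D where D: "D \<subseteq> F" "finite D" "pairwise disjnt D" "\<forall>A\<in>D. \<exists>x\<in>A. \<exists>y\<in>A. c < dist x y" "m < card D"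
        using unb by blast
      then obtain D' where D': "D' \<subseteq> D" "card D' = m"
        using obtain_subset_with_card_n[of m D] by (metis less_imp_le)
      then show ?thesis
        using D finite_subset[OF D'(1) D(2)] pairwise_subset[OF D(3) D'(1)]
        by (intro exI[of _ D'] conjI) auto
    qed
    then have "\<exists>L\<in>crowded X F. \<forall>e>0. \<exists>B\<in>F. \<exists>d>0. d \<le> e \<and> (\<exists>x\<in>B. \<exists>y\<in>B. c < dist x y) \<and> near e B L"
      using crowded_member_exists[OF compact F, of "\<lambda>e B. \<exists>x\<in>B. \<exists>y\<in>B. c < dist x y"] by simp
    then obtain L where L: "L \<in> crowded X F"
      "\<forall>e>0. \<exists>B\<in>F. \<exists>d>0. d \<le> e \<and> (\<exists>x\<in>B. \<exists>y\<in>B. c < dist x y) \<and> near e B L" by (rule bexE)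
    have "0 < c / 2" using c_pos by simp
    then obtain B x y where "x \<in> B" "y \<in> B" "c < dist x y" "near (c / 2) B L"
      using L(2) by blast
    then have "\<exists>x\<in>L. \<exists>y\<in>L. x \<noteq> y" using near_imp_nontrivial by blast
    then show False using triv[OF L(1)] by blast
  qed
  then show thesis using that by blast
qed

text \<open>The image of \<open>A\<close> under \<open>g\<close> is cut at both endpoints, which are
  more than \<open>c\<close> apart, into pieces within the closed balls of radius
  \<open>c / 3\<close>; these balls are disjoint. Each piece contains two points at distance at
  least \<open>c / 3\<close>, so some \<open>h\<close> in \<open>E\<close> expands it beyond
  \<open>c\<close>. Pulling back by \<open>g\<close> gives the pieces of \<open>A\<close>.\<close>

lemma split_member:
  assumes F: "admissible F" and A: "A \<in> F" and g: "g \<in> carrier G"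
    and xy: "x \<in> A" "y \<in> A" "c < dist (\<phi> g x) (\<phi> g y)"
    and E: "E \<subseteq> carrier G"
      "\<forall>x\<in>X. \<forall>y\<in>X. c / 3 \<le> dist x y \<longrightarrow> (\<exists>g\<in>E. c < dist (\<phi> g x) (\<phi> g y))"
  defines "sep \<equiv> \<lambda>C. \<exists>h\<in>E. \<exists>x\<in>C. \<exists>y\<in>C. c < dist (\<phi> (h \<otimes> g) x) (\<phi> (h \<otimes> g) y)"
  shows "\<exists>C1 C2. C1 \<in> F \<and> C2 \<in> F \<and> C1 \<subseteq> A \<and> C2 \<subseteq> A \<and> C1 \<inter> C2 = {} \<and> sep C1 \<and> sep C2"
proof -
  have FX: "\<And>B. B \<in> F \<Longrightarrow> B \<subseteq> X" and inv: "invariant F" and sp: "splittable F"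
    using F by (auto simp: admissible_def near_closed_def subcontinua_def)
  have part: "\<exists>C\<in>F. C \<subseteq> A \<and> \<phi> g ` C \<subseteq> cball (\<phi> g x) (c / 3) \<and> sep C"
    if x: "x \<in> A" and y: "y \<in> A" and xy: "c < dist (\<phi> g x) (\<phi> g y)" for x y
  proof -
    have gA: "\<phi> g ` A \<in> F" using inv A g by (simp add: invariant_def)
    have "c / 3 < dist (\<phi> g x) (\<phi> g y)" "0 < c / 3" using xy c_pos by auto
    then obtain B r where B: "B \<in> F" "\<phi> g x \<in> B" "B \<subseteq> \<phi> g ` A" "B \<subseteq> cball (\<phi> g x) (c / 3)"
      "r \<in> B" "c / 3 \<le> dist (\<phi> g x) r"
      using splittableD[OF sp gA imageI[OF x] imageI[OF y]] by metis
    define C where "C = \<phi> (inv g) ` B"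
    have "C \<in> F" using inv B(1) g by (simp add: C_def invariant_def)
    have CA: "C \<subseteq> A"
      using B(3) act_inv[OF g] FX[OF A] by (force simp: C_def)
    have gC: "\<phi> g ` C = B"
      using act_inv[of "inv g"] g FX[OF B(1)] by (force simp: C_def image_image)
    obtain h where h: "h \<in> E" "c < dist (\<phi> h (\<phi> g x)) (\<phi> h r)"
      using E(2) B(2,5,6) FX[OF B(1)] by blast
    obtain a b where ab: "a \<in> C" "\<phi> g x = \<phi> g a" "b \<in> C" "r = \<phi> g b"
      using gC B(2,5) by blast
    have "a \<in> X" "b \<in> X" using ab CA FX[OF A] by auto
    then have "c < dist (\<phi> (h \<otimes> g) a) (\<phi> (h \<otimes> g) b)"
      using h ab E(1) g by (simp add: act_mult subsetD)
    then have "sep C" using ab h(1) unfolding sep_def by blast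
    then show ?thesis using \<open>C \<in> F\<close> CA gC B(4) by blast
  qed
  obtain C1 where C1: "C1 \<in> F" "C1 \<subseteq> A" "\<phi> g ` C1 \<subseteq> cball (\<phi> g x) (c / 3)" "sep C1"
    using part[OF xy] by blast
  have "c < dist (\<phi> g y) (\<phi> g x)" using xy(3) by (simp add: dist_commute)
  then obtain C2 where C2: "C2 \<in> F" "C2 \<subseteq> A" "\<phi> g ` C2 \<subseteq> cball (\<phi> g y) (c / 3)" "sep C2"
    using part[OF xy(2,1)] by blast
  have "C1 \<inter> C2 = {}"
  proof (rule ccontr)
    assume "C1 \<inter> C2 \<noteq> {}"
    then obtain z where "z \<in> C1" "z \<in> C2" by blast
    then have "dist (\<phi> g x) (\<phi> g z) \<le> c / 3" "dist (\<phi> g y) (\<phi> g z) \<le> c / 3"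
      using C1(3) C2(3) by auto
    then show False using xy(3) c_pos dist_triangle2[of "\<phi> g x" "\<phi> g y" "\<phi> g z"] by linarith
  qed
  then show ?thesis using C1 C2 by blast
qed

text \<open>Each stage applies \<open>split_member\<close> to every continuum, which doubles their
  number and prepends one letter of \<open>E\<close> to the expanding word.\<close>

lemma exponentially_many_members:
  assumes F: "admissible F"
    and E: "E \<subseteq> carrier G"
      "\<forall>x\<in>X. \<forall>y\<in>X. c / 3 \<le> dist x y \<longrightarrow> (\<exists>g\<in>E. c < dist (\<phi> g x) (\<phi> g y))"
  shows "\<exists>D\<subseteq>F. finite D \<and> card D = 2 ^ n \<and> pairwise disjnt D \<and>
    (\<forall>A\<in>D. \<exists>g\<in>words G E n. \<exists>x\<in>A. \<exists>y\<in>A. c < dist (\<phi> g x) (\<phi> g y))"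
proof (induction n)
  case 0
  obtain A x y where A: "A \<in> F" "x \<in> A" "y \<in> A" "c < dist x y"
    using admissible_large_member[OF F] by blast
  have "F \<subseteq> subcontinua X" using F by (simp add: admissible_def near_closed_subset)
  then have "x \<in> X" "y \<in> X" using A by (auto simp: subcontinua_def)
  then have "\<exists>x\<in>A. \<exists>y\<in>A. c < dist (\<phi> \<one> x) (\<phi> \<one> y)" using A act_one by metis
  then show ?case using A(1) by (intro exI[of _ "{A}"]) simp
next
  case (Suc n)
  then obtain D where D: "D \<subseteq> F" "finite D" "card D = 2 ^ n" "pairwise disjnt D"
    "\<forall>A\<in>D. \<exists>g\<in>words G E n. \<exists>x\<in>A. \<exists>y\<in>A. c < dist (\<phi> g x) (\<phi> g y)" by blast
  define sep where "sep C \<longleftrightarrow> (\<exists>g\<in>words G E (Suc n). \<exists>x\<in>C. \<exists>y\<in>C. c < dist (\<phi> g x) (\<phi> g y))" for C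
  have "\<exists>C1 C2. C1 \<in> F \<and> C2 \<in> F \<and> C1 \<subseteq> A \<and> C2 \<subseteq> A \<and> C1 \<inter> C2 = {} \<and> sep C1 \<and> sep C2" if A: "A \<in> D" for A
  proof -
    obtain g x y where g: "g \<in> words G E n" "x \<in> A" "y \<in> A" "c < dist (\<phi> g x) (\<phi> g y)"
      using D(5) A by blast
    have gc: "g \<in> carrier G" using g(1) words_carrier[OF E(1)] by blast
    have AF: "A \<in> F" using A D(1) by blast
    obtain C1 C2 where C: "C1 \<in> F" "C2 \<in> F" "C1 \<subseteq> A" "C2 \<subseteq> A" "C1 \<inter> C2 = {}"
      "\<exists>h\<in>E. \<exists>x\<in>C1. \<exists>y\<in>C1. c < dist (\<phi> (h \<otimes> g) x) (\<phi> (h \<otimes> g) y)"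
      "\<exists>h\<in>E. \<exists>x\<in>C2. \<exists>y\<in>C2. c < dist (\<phi> (h \<otimes> g) x) (\<phi> (h \<otimes> g) y)"
      using split_member[OF F AF gc g(2,3,4) E] by metis
    have "h \<otimes> g \<in> words G E (Suc n)" if "h \<in> E" for h using that g(1) by auto
    then have "sep C1" "sep C2" using C(6,7) unfolding sep_def by meson+
    then show ?thesis using C by blast
  qed
  then obtain C1 C2 where C: "\<And>A. A \<in> D \<Longrightarrow> C1 A \<in> F \<and> C2 A \<in> F \<and> C1 A \<subseteq> A \<and> C2 A \<subseteq> A
      \<and> C1 A \<inter> C2 A = {} \<and> sep (C1 A) \<and> sep (C2 A)"
    by metis
  have sep_ne: "B \<noteq> {}" if "sep B" for B using that by (auto simp: sep_def)
  \<comment> \<open>Disjoint pieces are distinct only because they are nonempty; this makes the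
    number double exactly.\<close>
  have Cne: "C1 A \<noteq> {}" "C2 A \<noteq> {}" "C1 A \<noteq> C2 A" if "A \<in> D" for A
    using C[OF that] sep_ne by auto
  define D' where "D' = (\<Union>A\<in>D. {C1 A, C2 A})"
  have Disj: "A \<inter> B = {}" if "A \<in> D" "B \<in> D" "A \<noteq> B" for A B
    using D(4) that by (auto simp: pairwise_def disjnt_def)
  have "card D' = (\<Sum>A\<in>D. card {C1 A, C2 A})"
    unfolding D'_def
  proof (rule card_UN_disjoint[OF D(2)])
    show "\<forall>A\<in>D. \<forall>B\<in>D. A \<noteq> B \<longrightarrow> {C1 A, C2 A} \<inter> {C1 B, C2 B} = {}"
    proof (intro ballI impI)
      fix A B assume *: "A \<in> D" "B \<in> D" "A \<noteq> B"
      show "{C1 A, C2 A} \<inter> {C1 B, C2 B} = {}"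
      proof (rule ccontr)
        assume "\<not> ?thesis"
        then obtain Z where "Z \<in> {C1 A, C2 A}" "Z \<in> {C1 B, C2 B}" by blast
        then have "Z \<subseteq> A" "Z \<subseteq> B" "Z \<noteq> {}" using C[OF *(1)] C[OF *(2)] Cne[OF *(1)] by auto
        then show False using Disj[OF *] by blast
      qed
    qed
  qed auto
  also have "\<dots> = (\<Sum>A\<in>D. 2)" using Cne(3) by (intro sum.cong) auto
  also have "\<dots> = 2 ^ Suc n" using D(3) by simp
  finally have card: "card D' = 2 ^ Suc n" .
  have "pairwise disjnt D'"
  proof (rule pairwiseI)
    fix Y Z assume "Y \<in> D'" "Z \<in> D'" "Y \<noteq> Z"
    then obtain A B where AB: "A \<in> D" "Y \<in> {C1 A, C2 A}" "B \<in> D" "Z \<in> {C1 B, C2 B}"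
      unfolding D'_def by blast
    show "disjnt Y Z"
    proof (cases "A = B")
      case True
      then show ?thesis using AB C[OF AB(1)] \<open>Y \<noteq> Z\<close> by (auto simp: disjnt_def)
    next
      case False
      have "Y \<subseteq> A" "Z \<subseteq> B" using AB C by auto
      then show ?thesis using Disj[OF AB(1,3) False] by (auto simp: disjnt_def)
    qed
  qed
  moreover have "D' \<subseteq> F" "finite D'" "\<forall>Z\<in>D'. sep Z" using C D(2) by (auto simp: D'_def)
  ultimately show ?case using card unfolding sep_def by blast
qed

text \<open>Among the \<open>2 ^ n\<close> continua, those sharing one expanding word
  \<open>g\<close> are mapped by \<open>g\<close> to disjoint members of diameter above
  \<open>c\<close>, so there are at most \<open>M\<close> of them. Some word is shared by at least
  the average number.\<close>

theorem growth_bound: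
  assumes F: "admissible F" and M: "\<forall>D\<subseteq>F. finite D \<longrightarrow> pairwise disjnt D \<longrightarrow>
    (\<forall>A\<in>D. \<exists>x\<in>A. \<exists>y\<in>A. c < dist x y) \<longrightarrow> card D \<le> M"
    and E: "finite E" "E \<subseteq> carrier G"
      "\<forall>x\<in>X. \<forall>y\<in>X. c / 3 \<le> dist x y \<longrightarrow> (\<exists>g\<in>E. c < dist (\<phi> g x) (\<phi> g y))"
  shows "2 ^ n \<le> M * card (words G E n)"
proof -
  obtain D where D: "D \<subseteq> F" "finite D" "card D = 2 ^ n" "pairwise disjnt D"
    "\<forall>A\<in>D. \<exists>g\<in>words G E n. \<exists>x\<in>A. \<exists>y\<in>A. c < dist (\<phi> g x) (\<phi> g y)"
    using exponentially_many_members[OF F E(2,3)] by blast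
  then obtain s where s: "\<And>A. A \<in> D \<Longrightarrow> s A \<in> words G E n \<and> (\<exists>x\<in>A. \<exists>y\<in>A. c < dist (\<phi> (s A) x) (\<phi> (s A) y))"
    by metis
  have "\<exists>g\<in>words G E n. card (s -` {g} \<inter> D) * card (words G E n) \<ge> card D"
    using s D(2) words_finite[OF E(1)] words_one[of G E n] by (intro pigeonhole_card) auto
  then obtain g where g: "g \<in> words G E n" "2 ^ n \<le> card (s -` {g} \<inter> D) * card (words G E n)"
    using D(3) by auto
  have gc: "g \<in> carrier G" using g(1) words_carrier[OF E(2)] by blast
  let ?D = "s -` {g} \<inter> D"
  have FX: "F \<subseteq> Pow X" and inv: "invariant F"
    using F by (auto simp: admissible_def near_closed_def subcontinua_def)
  then have DX: "?D \<subseteq> Pow X" using D(1) by blast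
  have "card ((`) (\<phi> g) ` ?D) \<le> M"
  proof (rule M[rule_format])
    show "(`) (\<phi> g) ` ?D \<subseteq> F" using inv gc D(1) by (auto simp: invariant_def)
    show "finite ((`) (\<phi> g) ` ?D)" using D(2) by simp
    show "pairwise disjnt ((`) (\<phi> g) ` ?D)"
      using pairwise_subset[OF D(4)] by (intro pairwise_disjnt_image_act[OF gc DX]) auto
    show "\<exists>x\<in>A. \<exists>y\<in>A. c < dist x y" if "A \<in> (`) (\<phi> g) ` ?D" for A
      using that s by fastforce
  qed
  then have "card ?D \<le> M" using card_image[OF inj_on_image_act[OF gc DX]] by simp
  then have "card ?D * card (words G E n) \<le> M * card (words G E n)" by (rule mult_le_mono1)
  then show ?thesis using g(2) by linarith
qed

theorem not_suslinian_if_nilpotent: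
  assumes nil: "nilpotent_group G" and X: "continuum X" "nondegenerate X"
  shows "\<not> suslinian X"
proof
  assume sus: "suslinian X"
  obtain F where F: "admissible F" and min: "\<And>F'. admissible F' \<Longrightarrow> F' \<subseteq> F \<Longrightarrow> F' = F"
    using minimal_admissible[OF admissible_subcontinua[OF X]] by metis
  have nc: "near_closed X F" and FX: "F \<subseteq> subcontinua X" and inv: "invariant F" and sp: "splittable F"
    using F by (auto simp: admissible_def near_closed_def)
  \<comment> \<open>A nontrivial crowded continuum would make \<open>crowded X F\<close> an
    admissible subfamily, hence equal to \<open>F\<close> by minimality, and the Cantor scheme would
    contradict the Suslinian property.\<close>
  have "x = y" if A: "A \<in> crowded X F" "x \<in> A" "y \<in> A" for A x y
  proof (rule ccontr)
    assume "x \<noteq> y"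
    then have "admissible (crowded X F)"
      using A near_closed_crowded[OF FX] invariant_crowded[OF FX inv] splittable_crowded[OF compact FX sp]
      unfolding admissible_def by blast
    then have "crowded X F = F" using min crowded_subset[OF nc] by blast
    then have "\<exists>\<C>. uncountable \<C> \<and> pairwise disjnt \<C> \<and> (\<forall>C\<in>\<C>. C \<in> subcontinua X \<and> nondegenerate C)"
      using A \<open>x \<noteq> y\<close> by (intro crowded_family_not_suslinian[OF compact, of F A x y]) auto
    then show False using sus by (auto simp: suslinian_def subcontinua_def)
  qed
  then obtain M where M: "\<forall>D\<subseteq>F. finite D \<longrightarrow> pairwise disjnt D \<longrightarrow>
    (\<forall>A\<in>D. \<exists>x\<in>A. \<exists>y\<in>A. c < dist x y) \<longrightarrow> card D \<le> M"
    using large_members_bounded[OF FX] by metis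
  have "0 < c / 3" using c_pos by simp
  then obtain E where E: "finite E" "E \<subseteq> carrier G"
    "\<forall>x\<in>X. \<forall>y\<in>X. c / 3 \<le> dist x y \<longrightarrow> (\<exists>g\<in>E. c < dist (\<phi> g x) (\<phi> g y))"
    using uniform_expansivity by metis
  obtain k where k: "\<And>n. card (words G E n) \<le> (n + 2) ^ k"
    using nilpotent_polynomial_growth[OF nil E(1,2)] unfolding polynomial_growth_def by blast
  obtain n where "M * (n + 2) ^ k < 2 ^ n" using polynomial_less_exponential by blast
  moreover have "2 ^ n \<le> M * card (words G E n)" using growth_bound[OF F M E] by blast
  moreover have "M * card (words G E n) \<le> M * (n + 2) ^ k" using k by (rule mult_le_mono2)
  ultimately show False by linarith
qed

end

theorem corollary1p4:
  fixes G :: "('g, 'm) monoid_scheme" and X :: "'a::metric_space set"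
  assumes "group G"
    and "finitely_generated_group G"
    and "nilpotent_group G"
    and "suslinian X"
    and "nondegenerate X"
  shows "\<not> (\<exists>\<phi>. continuous_action G X \<phi> \<and> expansive_action G X \<phi>)"
proof
  assume "\<exists>\<phi>. continuous_action G X \<phi> \<and> expansive_action G X \<phi>"
  then obtain \<phi> where \<phi>: "continuous_action G X \<phi>" "expansive_action G X \<phi>" by blast
  have X: "continuum X" using assms(4) by (simp add: suslinian_def)
  then have compact: "compact X" by (simp add: continuum_def)
  interpret homeo_action G X \<phi>
    using assms(1) compact \<phi>(1) by (simp add: homeo_action_def homeo_action_axioms_def)
  obtain c where c: "0 < c"
    "\<And>x y. x \<in> X \<Longrightarrow> y \<in> X \<Longrightarrow> x \<noteq> y \<Longrightarrow> c < (SUP g\<in>carrier G. dist (\<phi> g x) (\<phi> g y))"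
    using \<phi>(2) unfolding expansive_action_def by blast
  have "\<exists>g\<in>carrier G. c < dist (\<phi> g x) (\<phi> g y)" if xy: "x \<in> X" "y \<in> X" "x \<noteq> y" for x y
  proof -
    \<comment> \<open>Boundedness by the diameter makes the real supremum genuine, so it exceeds
      \<open>c\<close> only if some group element does.\<close>
    have "bdd_above ((\<lambda>g. dist (\<phi> g x) (\<phi> g y)) ` carrier G)"
      using diameter_bounded_bound[OF compact_imp_bounded[OF compact]] act_in xy
      by (intro bdd_aboveI2[where M = "diameter X"]) auto
    then show ?thesis
      using c(2)[OF xy] less_cSUP_iff[of "carrier G" "\<lambda>g. dist (\<phi> g x) (\<phi> g y)" c] by auto
  qed
  then interpret expansive_homeo_action G X \<phi> c
    using c(1) by unfold_locales
  show False using not_suslinian_if_nilpotent[OF assms(3) X assms(5)] assms(4) by blast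
qed

end
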